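(* Let $(H,R)$ be a triangular Hopf algebra over a field $\Bbbk$. Regard the category ${}_H\mathcal{M}_H$ of $H$-bimodules as a subcategory of $\mathcal{LR}(H)$ by equipping each $H$-bimodule $M$ with the coactions $\rho^l(m)=R^2\otimes R^1\triangleright m$ and $\rho^r(m)=m\triangleleft R^1\otimes R^2$. Then this Yetter-Drinfel'd-Long subcategory ${}_H\mathcal{M}_H$ is symmetric, i.e. $\psi_{N,M}\circ\psi_{M,N}=\mathrm{id}_{M\otimes N}$ for all $H$-bimodules $M,N$ equipped with these coactions, where $\psi$ is the braiding of $\mathcal{LR}(H)$.
   Context: Everything is over a field $\Bbbk$; Sweedler notation $\Delta(h)=h_1\otimes h_2$ is used with summation omitted. A quasitriangular Hopf algebra is a pair $(H,R)$ with $H$ a Hopf algebra and $R=R^1\otimes R^2\in H\otimes H$ (summation omitted, $r=R$ a second copy) invertible such that $\Delta(R^1)\otimes R^2=R^1\otimes r^1\otimes R^2r^2$; $R^1\otimes\Delta(R^2)=R^1r^1\otimes r^2\otimes R^2$; $\Delta^{cop}(h)R=R\Delta(h)$ for all $h\in H$; $\varepsilon(R^1)R^2=1=R^1\varepsilon(R^2)$. It is triangular if moreover $R^{-1}=R^2\otimes R^1$. A Yetter-Drinfel'd-Long bimodule over $H$ is a vector space $M$ which is an $H$-bimodule (left action $h\otimes m\mapsto h\triangleright m$, right action $m\otimes h\mapsto m\triangleleft h$, with $(a\triangleright m)\triangleleft b=a\triangleright(m\triangleleft b)$) and an $H$-bicomodule (left coaction $\rho^l(m)=m_{[-1]}\otimes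 m_{[0]}\in H\otimes M$, right coaction $\rho^r(m)=m_{(0)}\otimes m_{(1)}\in M\otimes H$, with $m_{[-1]}\otimes m_{[0](0)}\otimes m_{[0](1)}=m_{(0)[-1]}\otimes m_{(0)[0]}\otimes m_{(1)}$), such that for all $h\in H$, $m\in M$: $(h_1\triangleright m)_{[-1]}h_2\otimes(h_1\triangleright m)_{[0]}=h_1m_{[-1]}\otimes h_2\triangleright m_{[0]}$; $(h\triangleright m)_{(0)}\otimes(h\triangleright m)_{(1)}=h\triangleright m_{(0)}\otimes m_{(1)}$; $(m\triangleleft h_2)_{(0)}\otimes h_1(m\triangleleft h_2)_{(1)}=m_{(0)}\triangleleft h_1\otimes m_{(1)}h_2$; $(m\triangleleft h)_{[-1]}\otimes(m\triangleleft h)_{[0]}=m_{[-1]}\otimes m_{[0]}\triangleleft h$. $\mathcal{LR}(H)$ is the category of Yetter-Drinfel'd-Long bimodules over $H$, with morphisms the $H$-bilinear and $H$-bicolinear maps. If the antipode of $H$ is bijective it is a braided monoidal category with $h\triangleright(m\otimes n)=h_1\triangleright m\otimes h_2\triangleright n$, $(m\otimes n)\triangleleft h=m\triangleleft h_1\otimes n\triangleleft h_2$, $(m\otimes n)_{[-1]}\otimes(m\otimes n)_{[0]}=m_{[-1]}n_{[-1]}\otimes m_{[0]}\otimes n_{[0]}$, $(m\otimes n)_{(0)}\otimes(m\otimes n)_{(1)}=m_{(0)}\otimes n_{(0)}\otimes m_{(1)}n_{(1)}$, and braiding $\psi_{M,N}:M\otimes N\to N\otimes M$, $\psi_{M,N}(m\otimes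 n)=m_{[-1]}\triangleright n_{(0)}\otimes m_{[0]}\triangleleft n_{(1)}$. *)

theory Defs
  imports "HOL-Algebra.Module"
begin

section \<open>Linear maps and tensor products\<close>

text \<open>A vector space over a field \<open>K\<close> is a \<open>module K M\<close>; the fields \<open>mult\<close> and \<open>one\<close> of the record
  \<open>M\<close> play no role unless \<open>M\<close> is an algebra.\<close>

definition linear_map ::
  "('k, 'r) ring_scheme \<Rightarrow> ('k, 'm, 'x) module_scheme \<Rightarrow> ('k, 'n, 'y) module_scheme \<Rightarrow> ('m \<Rightarrow> 'n) \<Rightarrow> bool"
  where "linear_map K M N f \<longleftrightarrow>
    f \<in> carrier M \<rightarrow> carrier N \<and>
    (\<forall>x\<in>carrier M. \<forall>y\<in>carrier M. f (x \<oplus>\<^bsub>M\<^esub> y) = f x \<oplus>\<^bsub>N\<^esub> f y) \<and>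
    (\<forall>c\<in>carrier K. \<forall>x\<in>carrier M. f (c \<odot>\<^bsub>M\<^esub> x) = c \<odot>\<^bsub>N\<^esub> f x)"

definition bilinear_map ::
  "('k, 'r) ring_scheme \<Rightarrow> ('k, 'm, 'x) module_scheme \<Rightarrow> ('k, 'n, 'y) module_scheme \<Rightarrow>
    ('k, 'v, 'z) module_scheme \<Rightarrow> ('m \<Rightarrow> 'n \<Rightarrow> 'v) \<Rightarrow> bool"
  where "bilinear_map K M N V \<beta> \<longleftrightarrow>
    (\<forall>m\<in>carrier M. linear_map K N V (\<beta> m)) \<and>
    (\<forall>n\<in>carrier N. linear_map K M V (\<lambda>m. \<beta> m n))"

text \<open>A list \<open>[(m\<^sub>1, n\<^sub>1), \<dots>, (m\<^sub>r, n\<^sub>r)]\<close> stands for the formal sum of the symbols \<open>m\<^sub>i \<otimes> n\<^sub>i\<close>.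
  Two such sums are equivalent iff the usual bilinearity relations identify them. Scalars are
  absorbed into the symbols, so no formal coefficients are needed.\<close>

inductive tensor_equiv ::
  "('k, 'r) ring_scheme \<Rightarrow> ('k, 'm, 'x) module_scheme \<Rightarrow> ('k, 'n, 'y) module_scheme \<Rightarrow>
    ('m \<times> 'n) list \<Rightarrow> ('m \<times> 'n) list \<Rightarrow> bool"
  for K and M (structure) and N (structure)
  where
    refl: "set xs \<subseteq> carrier M \<times> carrier N \<Longrightarrow> tensor_equiv K M N xs xs"
  | sym: "tensor_equiv K M N xs ys \<Longrightarrow> tensor_equiv K M N ys xs"
  | trans: "tensor_equiv K M N xs ys \<Longrightarrow> tensor_equiv K M N ys zs \<Longrightarrow> tensor_equiv K M N xs zs"
  | append: "tensor_equiv K M N xs ys \<Longrightarrow> tensor_equiv K M N us vs \<Longrightarrow>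
      tensor_equiv K M N (xs @ us) (ys @ vs)"
  | commute: "set xs \<subseteq> carrier M \<times> carrier N \<Longrightarrow> set ys \<subseteq> carrier M \<times> carrier N \<Longrightarrow>
      tensor_equiv K M N (xs @ ys) (ys @ xs)"
  | zero: "n \<in> carrier N \<Longrightarrow> tensor_equiv K M N [(\<zero>\<^bsub>M\<^esub>, n)] []"
  | add_left: "m \<in> carrier M \<Longrightarrow> m' \<in> carrier M \<Longrightarrow> n \<in> carrier N \<Longrightarrow>
      tensor_equiv K M N [(m \<oplus>\<^bsub>M\<^esub> m', n)] [(m, n), (m', n)]"
  | add_right: "m \<in> carrier M \<Longrightarrow> n \<in> carrier N \<Longrightarrow> n' \<in> carrier N \<Longrightarrow>
      tensor_equiv K M N [(m, n \<oplus>\<^bsub>N\<^esub> n')] [(m, n), (m, n')]"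
  | scalar: "c \<in> carrier K \<Longrightarrow> m \<in> carrier M \<Longrightarrow> n \<in> carrier N \<Longrightarrow>
      tensor_equiv K M N [(c \<odot>\<^bsub>M\<^esub> m, n)] [(m, c \<odot>\<^bsub>N\<^esub> n)]"

definition tensor_class ::
  "('k, 'r) ring_scheme \<Rightarrow> ('k, 'm, 'x) module_scheme \<Rightarrow> ('k, 'n, 'y) module_scheme \<Rightarrow>
    ('m \<times> 'n) list \<Rightarrow> ('m \<times> 'n) list set"
  where "tensor_class K M N xs = {ys. tensor_equiv K M N xs ys}"

text \<open>The multiplication \<open>(a \<otimes> b) (c \<otimes> d) = a c \<otimes> b d\<close> and the unit \<open>1 \<otimes> 1\<close> are meaningful only when
  \<open>M\<close> and \<open>N\<close> are algebras.\<close>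

definition tensor ::
  "('k, 'r) ring_scheme \<Rightarrow> ('k, 'm, 'x) module_scheme \<Rightarrow> ('k, 'n, 'y) module_scheme \<Rightarrow>
    ('k, ('m \<times> 'n) list set) module"
  where "tensor K M N =
    \<lparr>carrier = tensor_class K M N ` {xs. set xs \<subseteq> carrier M \<times> carrier N},
     mult = (\<lambda>s t. \<Union>xs\<in>s. \<Union>ys\<in>t. tensor_class K M N
       [(a \<otimes>\<^bsub>M\<^esub> c, b \<otimes>\<^bsub>N\<^esub> d). (a, b) \<leftarrow> xs, (c, d) \<leftarrow> ys]),
     one = tensor_class K M N [(\<one>\<^bsub>M\<^esub>, \<one>\<^bsub>N\<^esub>)],
     zero = tensor_class K M N [],
     add = (\<lambda>s t. \<Union>xs\<in>s. \<Union>ys\<in>t. tensor_class K M N (xs @ ys)),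
     smult = (\<lambda>c s. \<Union>xs\<in>s. tensor_class K M N [(c \<odot>\<^bsub>M\<^esub> m, n). (m, n) \<leftarrow> xs])\<rparr>"

definition pure_tensor ::
  "('k, 'r) ring_scheme \<Rightarrow> ('k, 'm, 'x) module_scheme \<Rightarrow> ('k, 'n, 'y) module_scheme \<Rightarrow>
    'm \<Rightarrow> 'n \<Rightarrow> ('m \<times> 'n) list set"
  where "pure_tensor K M N m n = tensor_class K M N [(m, n)]"

text \<open>\<open>sweedler V t (\<lambda>m n. \<beta> m n)\<close> is the sum in \<open>V\<close> of the \<open>\<beta> m n\<close>, where the tensor \<open>t\<close> is the sum of the
  \<open>m \<otimes> n\<close>: the value at \<open>t\<close> of the linear map induced by \<open>\<beta>\<close>. It does not depend on the chosen
  representative as long as \<open>\<beta>\<close> is bilinear, which is the case in all uses below.\<close>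

definition sweedler ::
  "('k, 'v, 'z) module_scheme \<Rightarrow> ('m \<times> 'n) list set \<Rightarrow> ('m \<Rightarrow> 'n \<Rightarrow> 'v) \<Rightarrow> 'v"
  where "sweedler V t \<beta> = foldr (\<lambda>(m, n) v. \<beta> m n \<oplus>\<^bsub>V\<^esub> v) (SOME xs. xs \<in> t) \<zero>\<^bsub>V\<^esub>"

definition tensor_flip ::
  "('k, 'r) ring_scheme \<Rightarrow> ('k, 'm, 'x) module_scheme \<Rightarrow> ('k, 'n, 'y) module_scheme \<Rightarrow>
    ('m \<times> 'n) list set \<Rightarrow> ('n \<times> 'm) list set"
  where "tensor_flip K M N t = sweedler (tensor K N M) t (\<lambda>m n. pure_tensor K N M n m)"


section \<open>Hopf algebras\<close>

record ('k, 'h) hopf = "('k, 'h) module" +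
  comult :: "'h \<Rightarrow> ('h \<times> 'h) list set"
  counit :: "'h \<Rightarrow> 'k"
  antipode :: "'h \<Rightarrow> 'h"

text \<open>The library locale \<open>algebra\<close> is restricted to commutative algebras.\<close>

locale assoc_algebra = field K + module K A + ring A
  for K :: "('k, 'r) ring_scheme" and A :: "('k, 'h, 'x) module_scheme" +
  assumes smult_mult_left: "\<lbrakk>c \<in> carrier K; x \<in> carrier A; y \<in> carrier A\<rbrakk> \<Longrightarrow>
      (c \<odot>\<^bsub>A\<^esub> x) \<otimes>\<^bsub>A\<^esub> y = c \<odot>\<^bsub>A\<^esub> (x \<otimes>\<^bsub>A\<^esub> y)"
    and smult_mult_right: "\<lbrakk>c \<in> carrier K; x \<in> carrier A; y \<in> carrier A\<rbrakk> \<Longrightarrow>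
      x \<otimes>\<^bsub>A\<^esub> (c \<odot>\<^bsub>A\<^esub> y) = c \<odot>\<^bsub>A\<^esub> (x \<otimes>\<^bsub>A\<^esub> y)"

locale hopf_algebra = assoc_algebra K H
  for K :: "('k, 'r) ring_scheme" and H :: "('k, 'h, 'x) hopf_scheme" +
  assumes comult_linear: "linear_map K H (tensor K H H) (comult H)"
    and counit_closed: "counit H \<in> carrier H \<rightarrow> carrier K"
    and counit_smult: "\<lbrakk>c \<in> carrier K; x \<in> carrier H\<rbrakk> \<Longrightarrow>
      counit H (c \<odot>\<^bsub>H\<^esub> x) = c \<otimes>\<^bsub>K\<^esub> counit H x"
    and coassoc: "h \<in> carrier H \<Longrightarrow>
      sweedler (tensor K H (tensor K H H)) (comult H h) (\<lambda>h1 h2.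
        sweedler (tensor K H (tensor K H H)) (comult H h1) (\<lambda>a b.
          pure_tensor K H (tensor K H H) a (pure_tensor K H H b h2))) =
      sweedler (tensor K H (tensor K H H)) (comult H h) (\<lambda>h1 h2.
        pure_tensor K H (tensor K H H) h1 (comult H h2))"
    and counit_left: "h \<in> carrier H \<Longrightarrow>
      sweedler H (comult H h) (\<lambda>h1 h2. counit H h1 \<odot>\<^bsub>H\<^esub> h2) = h"
    and counit_right: "h \<in> carrier H \<Longrightarrow>
      sweedler H (comult H h) (\<lambda>h1 h2. counit H h2 \<odot>\<^bsub>H\<^esub> h1) = h"
    and comult_hom: "comult H \<in> ring_hom H (tensor K H H)"
    and counit_hom: "counit H \<in> ring_hom H K"
    and antipode_linear: "linear_map K H H (antipode H)"
    and antipode_left: "h \<in> carrier H \<Longrightarrow>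
      sweedler H (comult H h) (\<lambda>h1 h2. antipode H h1 \<otimes>\<^bsub>H\<^esub> h2) = counit H h \<odot>\<^bsub>H\<^esub> \<one>\<^bsub>H\<^esub>"
    and antipode_right: "h \<in> carrier H \<Longrightarrow>
      sweedler H (comult H h) (\<lambda>h1 h2. h1 \<otimes>\<^bsub>H\<^esub> antipode H h2) = counit H h \<odot>\<^bsub>H\<^esub> \<one>\<^bsub>H\<^esub>"

locale quasitriangular_hopf_algebra = hopf_algebra K H
  for K :: "('k, 'r) ring_scheme" and H :: "('k, 'h, 'x) hopf_scheme" +
  fixes R :: "('h \<times> 'h) list set"
  assumes R_invertible: "R \<in> Units (tensor K H H)"
    and R_comult_left:
      "sweedler (tensor K H (tensor K H H)) R (\<lambda>R1 R2.
        sweedler (tensor K H (tensor K H H)) (comult H R1) (\<lambda>a b.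
          pure_tensor K H (tensor K H H) a (pure_tensor K H H b R2))) =
       sweedler (tensor K H (tensor K H H)) R (\<lambda>R1 R2.
        sweedler (tensor K H (tensor K H H)) R (\<lambda>r1 r2.
          pure_tensor K H (tensor K H H) R1 (pure_tensor K H H r1 (R2 \<otimes>\<^bsub>H\<^esub> r2))))"
    and R_comult_right:
      "sweedler (tensor K H (tensor K H H)) R (\<lambda>R1 R2.
        pure_tensor K H (tensor K H H) R1 (comult H R2)) =
       sweedler (tensor K H (tensor K H H)) R (\<lambda>R1 R2.
        sweedler (tensor K H (tensor K H H)) R (\<lambda>r1 r2.
          pure_tensor K H (tensor K H H) (R1 \<otimes>\<^bsub>H\<^esub> r1) (pure_tensor K H H r2 R2)))"
    and R_cop: "h \<in> carrier H \<Longrightarrow>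
      tensor_flip K H H (comult H h) \<otimes>\<^bsub>tensor K H H\<^esub> R = R \<otimes>\<^bsub>tensor K H H\<^esub> comult H h"
    and R_counit_left: "sweedler H R (\<lambda>R1 R2. counit H R1 \<odot>\<^bsub>H\<^esub> R2) = \<one>\<^bsub>H\<^esub>"
    and R_counit_right: "sweedler H R (\<lambda>R1 R2. counit H R2 \<odot>\<^bsub>H\<^esub> R1) = \<one>\<^bsub>H\<^esub>"

locale triangular_hopf_algebra = quasitriangular_hopf_algebra +
  assumes R_triangular: "inv\<^bsub>tensor K H H\<^esub> R = tensor_flip K H H R"


section \<open>Bimodules and Yetter-Drinfel'd-Long bimodules\<close>

record ('k, 'h, 'm) bimodule = "('k, 'm) module" +
  lact :: "'h \<Rightarrow> 'm \<Rightarrow> 'm" (infixr \<open>\<triangleright>\<index>\<close> 76)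
  ract :: "'m \<Rightarrow> 'h \<Rightarrow> 'm" (infixl \<open>\<triangleleft>\<index>\<close> 75)

record ('k, 'h, 'm) ydl = "('k, 'h, 'm) bimodule" +
  lcoact :: "'m \<Rightarrow> ('h \<times> 'm) list set"
  rcoact :: "'m \<Rightarrow> ('m \<times> 'h) list set"

locale hopf_bimodule = hopf_algebra K H + M: module K M
  for K :: "('k, 'r) ring_scheme" and H :: "('k, 'h, 'x) hopf_scheme"
    and M :: "('k, 'h, 'm, 'y) bimodule_scheme" +
  assumes lact_bilinear: "bilinear_map K H M M (\<lambda>h m. h \<triangleright>\<^bsub>M\<^esub> m)"
    and ract_bilinear: "bilinear_map K M H M (\<lambda>m h. m \<triangleleft>\<^bsub>M\<^esub> h)"
    and lact_one: "m \<in> carrier M \<Longrightarrow> \<one>\<^bsub>H\<^esub> \<triangleright>\<^bsub>M\<^esub> m = m"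
    and ract_one: "m \<in> carrier M \<Longrightarrow> m \<triangleleft>\<^bsub>M\<^esub> \<one>\<^bsub>H\<^esub> = m"
    and lact_mult: "\<lbrakk>a \<in> carrier H; b \<in> carrier H; m \<in> carrier M\<rbrakk> \<Longrightarrow>
      (a \<otimes>\<^bsub>H\<^esub> b) \<triangleright>\<^bsub>M\<^esub> m = a \<triangleright>\<^bsub>M\<^esub> (b \<triangleright>\<^bsub>M\<^esub> m)"
    and ract_mult: "\<lbrakk>a \<in> carrier H; b \<in> carrier H; m \<in> carrier M\<rbrakk> \<Longrightarrow>
      m \<triangleleft>\<^bsub>M\<^esub> (a \<otimes>\<^bsub>H\<^esub> b) = (m \<triangleleft>\<^bsub>M\<^esub> a) \<triangleleft>\<^bsub>M\<^esub> b"
    and lact_ract: "\<lbrakk>a \<in> carrier H; b \<in> carrier H; m \<in> carrier M\<rbrakk> \<Longrightarrow>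
      (a \<triangleright>\<^bsub>M\<^esub> m) \<triangleleft>\<^bsub>M\<^esub> b = a \<triangleright>\<^bsub>M\<^esub> (m \<triangleleft>\<^bsub>M\<^esub> b)"

locale hopf_bicomodule = hopf_algebra K H + M: module K M
  for K :: "('k, 'r) ring_scheme" and H :: "('k, 'h, 'x) hopf_scheme"
    and M :: "('k, 'h, 'm, 'y) ydl_scheme" +
  assumes lcoact_linear: "linear_map K M (tensor K H M) (lcoact M)"
    and rcoact_linear: "linear_map K M (tensor K M H) (rcoact M)"
    and lcoact_coassoc: "m \<in> carrier M \<Longrightarrow>
      sweedler (tensor K H (tensor K H M)) (lcoact M m) (\<lambda>a m0.
        sweedler (tensor K H (tensor K H M)) (comult H a) (\<lambda>a1 a2.
          pure_tensor K H (tensor K H M) a1 (pure_tensor K H M a2 m0))) =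
      sweedler (tensor K H (tensor K H M)) (lcoact M m) (\<lambda>a m0.
        pure_tensor K H (tensor K H M) a (lcoact M m0))"
    and lcoact_counit: "m \<in> carrier M \<Longrightarrow>
      sweedler M (lcoact M m) (\<lambda>a m0. counit H a \<odot>\<^bsub>M\<^esub> m0) = m"
    and rcoact_coassoc: "m \<in> carrier M \<Longrightarrow>
      sweedler (tensor K M (tensor K H H)) (rcoact M m) (\<lambda>m0 b.
        sweedler (tensor K M (tensor K H H)) (rcoact M m0) (\<lambda>m00 b'.
          pure_tensor K M (tensor K H H) m00 (pure_tensor K H H b' b))) =
      sweedler (tensor K M (tensor K H H)) (rcoact M m) (\<lambda>m0 b.
        pure_tensor K M (tensor K H H) m0 (comult H b))"
    and rcoact_counit: "m \<in> carrier M \<Longrightarrow>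
      sweedler M (rcoact M m) (\<lambda>m0 b. counit H b \<odot>\<^bsub>M\<^esub> m0) = m"
    and lcoact_rcoact: "m \<in> carrier M \<Longrightarrow>
      sweedler (tensor K H (tensor K M H)) (lcoact M m) (\<lambda>a m0.
        pure_tensor K H (tensor K M H) a (rcoact M m0)) =
      sweedler (tensor K H (tensor K M H)) (rcoact M m) (\<lambda>m0 b.
        sweedler (tensor K H (tensor K M H)) (lcoact M m0) (\<lambda>a m00.
          pure_tensor K H (tensor K M H) a (pure_tensor K M H m00 b)))"

locale ydl_bimodule = hopf_bimodule K H M + hopf_bicomodule K H M
  for K :: "('k, 'r) ring_scheme" and H :: "('k, 'h, 'x) hopf_scheme"
    and M :: "('k, 'h, 'm, 'y) ydl_scheme" +
  assumes lact_lcoact: "\<lbrakk>h \<in> carrier H; m \<in> carrier M\<rbrakk> \<Longrightarrow>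
      sweedler (tensor K H M) (comult H h) (\<lambda>h1 h2.
        sweedler (tensor K H M) (lcoact M (h1 \<triangleright>\<^bsub>M\<^esub> m)) (\<lambda>a m0.
          pure_tensor K H M (a \<otimes>\<^bsub>H\<^esub> h2) m0)) =
      sweedler (tensor K H M) (comult H h) (\<lambda>h1 h2.
        sweedler (tensor K H M) (lcoact M m) (\<lambda>a m0.
          pure_tensor K H M (h1 \<otimes>\<^bsub>H\<^esub> a) (h2 \<triangleright>\<^bsub>M\<^esub> m0)))"
    and lact_rcoact: "\<lbrakk>h \<in> carrier H; m \<in> carrier M\<rbrakk> \<Longrightarrow>
      rcoact M (h \<triangleright>\<^bsub>M\<^esub> m) =
      sweedler (tensor K M H) (rcoact M m) (\<lambda>m0 b. pure_tensor K M H (h \<triangleright>\<^bsub>M\<^esub> m0) b)"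
    and ract_rcoact: "\<lbrakk>h \<in> carrier H; m \<in> carrier M\<rbrakk> \<Longrightarrow>
      sweedler (tensor K M H) (comult H h) (\<lambda>h1 h2.
        sweedler (tensor K M H) (rcoact M (m \<triangleleft>\<^bsub>M\<^esub> h2)) (\<lambda>m0 b.
          pure_tensor K M H m0 (h1 \<otimes>\<^bsub>H\<^esub> b))) =
      sweedler (tensor K M H) (comult H h) (\<lambda>h1 h2.
        sweedler (tensor K M H) (rcoact M m) (\<lambda>m0 b.
          pure_tensor K M H (m0 \<triangleleft>\<^bsub>M\<^esub> h1) (b \<otimes>\<^bsub>H\<^esub> h2)))"
    and ract_lcoact: "\<lbrakk>h \<in> carrier H; m \<in> carrier M\<rbrakk> \<Longrightarrow>
      lcoact M (m \<triangleleft>\<^bsub>M\<^esub> h) =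
      sweedler (tensor K H M) (lcoact M m) (\<lambda>a m0. pure_tensor K H M a (m0 \<triangleleft>\<^bsub>M\<^esub> h))"

definition bimodule_hom ::
  "('k, 'r) ring_scheme \<Rightarrow> ('k, 'h, 'x) hopf_scheme \<Rightarrow> ('k, 'h, 'm, 'y) bimodule_scheme \<Rightarrow>
    ('k, 'h, 'n, 'z) bimodule_scheme \<Rightarrow> ('m \<Rightarrow> 'n) \<Rightarrow> bool"
  where "bimodule_hom K H M N f \<longleftrightarrow>
    linear_map K M N f \<and>
    (\<forall>h\<in>carrier H. \<forall>m\<in>carrier M. f (h \<triangleright>\<^bsub>M\<^esub> m) = h \<triangleright>\<^bsub>N\<^esub> f m) \<and>
    (\<forall>h\<in>carrier H. \<forall>m\<in>carrier M. f (m \<triangleleft>\<^bsub>M\<^esub> h) = f m \<triangleleft>\<^bsub>N\<^esub> h)"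

definition ydl_hom ::
  "('k, 'r) ring_scheme \<Rightarrow> ('k, 'h, 'x) hopf_scheme \<Rightarrow> ('k, 'h, 'm, 'y) ydl_scheme \<Rightarrow>
    ('k, 'h, 'n, 'z) ydl_scheme \<Rightarrow> ('m \<Rightarrow> 'n) \<Rightarrow> bool"
  where "ydl_hom K H M N f \<longleftrightarrow>
    bimodule_hom K H M N f \<and>
    (\<forall>m\<in>carrier M. lcoact N (f m) =
      sweedler (tensor K H N) (lcoact M m) (\<lambda>a m0. pure_tensor K H N a (f m0))) \<and>
    (\<forall>m\<in>carrier M. rcoact N (f m) =
      sweedler (tensor K N H) (rcoact M m) (\<lambda>m0 b. pure_tensor K N H (f m0) b))"

definition ydl_braiding ::
  "('k, 'r) ring_scheme \<Rightarrow> ('k, 'h, 'm, 'y) ydl_scheme \<Rightarrow> ('k, 'h, 'n, 'z) ydl_scheme \<Rightarrow>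
    ('m \<times> 'n) list set \<Rightarrow> ('n \<times> 'm) list set"
  where "ydl_braiding K M N t =
    sweedler (tensor K N M) t (\<lambda>m n.
      sweedler (tensor K N M) (lcoact M m) (\<lambda>a m0.
        sweedler (tensor K N M) (rcoact N n) (\<lambda>n0 b.
          pure_tensor K N M (a \<triangleright>\<^bsub>N\<^esub> n0) (m0 \<triangleleft>\<^bsub>M\<^esub> b))))"

definition ydl_of_bimodule ::
  "('k, 'r) ring_scheme \<Rightarrow> ('k, 'h, 'x) hopf_scheme \<Rightarrow> ('h \<times> 'h) list set \<Rightarrow>
    ('k, 'h, 'm) bimodule \<Rightarrow> ('k, 'h, 'm) ydl"
  where "ydl_of_bimodule K H R M = bimodule.extend M
    (ydl.fields
      (\<lambda>m. sweedler (tensor K H M) R (\<lambda>R1 R2. pure_tensor K H M R2 (R1 \<triangleright>\<^bsub>M\<^esub> m)))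
      (\<lambda>m. sweedler (tensor K M H) R (\<lambda>R1 R2. pure_tensor K M H (m \<triangleleft>\<^bsub>M\<^esub> R1) R2)))"

end

theory Submission
  imports Defs
begin

text \<open>
  Write \<open>r\<close> for a second copy of \<open>R\<close>. The coaction \<open>\<rho>\<^sup>l(m) = R\<^sup>2 \<otimes> R\<^sup>1 \<triangleright> m\<close> is coassociative by
  \<open>R\<^sup>1 \<otimes> \<Delta>(R\<^sup>2) = R\<^sup>1 r\<^sup>1 \<otimes> r\<^sup>2 \<otimes> R\<^sup>2\<close> and counital by \<open>R\<^sup>1 \<epsilon>(R\<^sup>2) = 1\<close>; the same two axioms serve
  \<open>\<rho>\<^sup>r(m) = m \<triangleleft> R\<^sup>1 \<otimes> R\<^sup>2\<close>. The compatibility of each coaction with the action on its own side is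
  \<open>\<Delta>\<^sup>c\<^sup>o\<^sup>p(h) R = R \<Delta>(h)\<close> applied to \<open>m\<close> (\<open>lact_lco\<close>, \<open>ract_rco\<close>), and everything that relates the
  two sides holds because the left and the right action commute. A bimodule map commutes with the
  actions of \<open>R\<^sup>1\<close> and is therefore bicolinear.

  For these coactions the braiding is
  \<open>\<psi>(m \<otimes> n) = R\<^sup>2 \<triangleright> n \<triangleleft> r\<^sup>1 \<otimes> R\<^sup>1 \<triangleright> m \<triangleleft> r\<^sup>2\<close>. In its square the left actions on \<open>m \<otimes> n\<close> combine to
  the element \<open>R\<^sub>2\<^sub>1 R\<close> of \<open>H \<otimes> H\<close>, and so do the right actions. Triangularity says that
  \<open>R\<^sub>2\<^sub>1 R = 1 \<otimes> 1\<close> (\<open>R_flip_mult\<close>), so the square is the identity on pure tensors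
  (\<open>braid_braid_pure\<close>) and, by linearity, everywhere.

  Most of the work is to justify the Sweedler calculus for tensors that are classes of lists:
  the tensor product is a module (\<open>tensor_module\<close>), a bilinear map induces a linear map on it
  (\<open>sweedler_linear\<close>), a tensor given by a sum can be substituted into such a map
  (\<open>sweedler_sweedler_pure\<close>), independent sums can be interchanged (\<open>sweedler_swap\<close>), and
  \<open>H \<otimes> H\<close> is a monoid (\<open>tensor_monoid\<close>). An axiom for \<open>R\<close> is then used by applying
  the map induced by a bilinear or trilinear map to both of its sides.
\<close>

section \<open>Linear and bilinear maps\<close>

lemma linear_mapI:
  assumes "\<And>x. x \<in> carrier M \<Longrightarrow> f x \<in> carrier N"
    and "\<And>x y. \<lbrakk>x \<in> carrier M; y \<in> carrier M\<rbrakk> \<Longrightarrow> f (x \<oplus>\<^bsub>M\<^esub> y) = f x \<oplus>\<^bsub>N\<^esub> f y"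
    and "\<And>c x. \<lbrakk>c \<in> carrier K; x \<in> carrier M\<rbrakk> \<Longrightarrow> f (c \<odot>\<^bsub>M\<^esub> x) = c \<odot>\<^bsub>N\<^esub> f x"
  shows "linear_map K M N f"
  using assms unfolding linear_map_def by auto

lemma linear_map_closed: "\<lbrakk>linear_map K M N f; x \<in> carrier M\<rbrakk> \<Longrightarrow> f x \<in> carrier N"
  and linear_map_add: "\<lbrakk>linear_map K M N f; x \<in> carrier M; y \<in> carrier M\<rbrakk> \<Longrightarrow>
    f (x \<oplus>\<^bsub>M\<^esub> y) = f x \<oplus>\<^bsub>N\<^esub> f y"
  and linear_map_smult: "\<lbrakk>linear_map K M N f; c \<in> carrier K; x \<in> carrier M\<rbrakk> \<Longrightarrow>
    f (c \<odot>\<^bsub>M\<^esub> x) = c \<odot>\<^bsub>N\<^esub> f x"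
  unfolding linear_map_def by auto

lemma linear_map_zero:
  assumes "module K M" "module K N" "linear_map K M N f"
  shows "f \<zero>\<^bsub>M\<^esub> = \<zero>\<^bsub>N\<^esub>"
proof -
  interpret M: module K M by fact
  interpret N: module K N by fact
  have "f \<zero>\<^bsub>M\<^esub> = f (\<zero>\<^bsub>K\<^esub> \<odot>\<^bsub>M\<^esub> \<zero>\<^bsub>M\<^esub>)" by simp
  also have "\<dots> = \<zero>\<^bsub>K\<^esub> \<odot>\<^bsub>N\<^esub> f \<zero>\<^bsub>M\<^esub>"
    by (rule linear_map_smult[OF assms(3)]) auto
  also have "\<dots> = \<zero>\<^bsub>N\<^esub>"
    using linear_map_closed[OF assms(3)] by simp
  finally show ?thesis .
qed

lemma linear_map_cong:
  assumes "module K M" "linear_map K M N g" "\<And>x. x \<in> carrier M \<Longrightarrow> f x = g x"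
  shows "linear_map K M N f"
proof -
  interpret M: module K M by fact
  show ?thesis using assms(2,3) unfolding linear_map_def by (auto simp: Pi_iff)
qed

lemma linear_map_id [simp]: "linear_map K M M (\<lambda>x. x)"
  by (simp add: linear_map_def)

lemma linear_map_compose:
  "\<lbrakk>linear_map K V W g; linear_map K M V f\<rbrakk> \<Longrightarrow> linear_map K M W (\<lambda>x. g (f x))"
  unfolding linear_map_def by (auto simp: Pi_iff)

lemma bilinear_mapI:
  assumes "\<And>m. m \<in> carrier M \<Longrightarrow> linear_map K N V (\<lambda>n. \<beta> m n)"
    and "\<And>n. n \<in> carrier N \<Longrightarrow> linear_map K M V (\<lambda>m. \<beta> m n)"
  shows "bilinear_map K M N V \<beta>"
  using assms unfolding bilinear_map_def by simp

lemma bilinear_map_right: "\<lbrakk>bilinear_map K M N V \<beta>; m \<in> carrier M\<rbrakk> \<Longrightarrow> linear_map K N V (\<beta> m)"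
  and bilinear_map_left: "\<lbrakk>bilinear_map K M N V \<beta>; n \<in> carrier N\<rbrakk> \<Longrightarrow> linear_map K M V (\<lambda>m. \<beta> m n)"
  unfolding bilinear_map_def by auto

lemma bilinear_map_closed:
  "\<lbrakk>bilinear_map K M N V \<beta>; m \<in> carrier M; n \<in> carrier N\<rbrakk> \<Longrightarrow> \<beta> m n \<in> carrier V"
  using bilinear_map_right linear_map_closed by fastforce

section \<open>Sums over lists of pairs\<close>

text \<open>\<open>list_sum V \<beta> xs\<close> is the sum of \<open>\<beta> m n\<close> over the entries \<open>(m, n)\<close> of a formal sum of
  symbols; \<open>sweedler\<close> takes this sum over a chosen representative of a tensor. Interchange of
  sums, additivity and compatibility with linear maps hold already at this level, for any
  \<open>\<beta>\<close> with values in \<open>V\<close>; bilinearity matters only for the choice of the representative.\<close>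

definition list_sum ::
  "('k, 'v, 'z) module_scheme \<Rightarrow> ('m \<Rightarrow> 'n \<Rightarrow> 'v) \<Rightarrow> ('m \<times> 'n) list \<Rightarrow> 'v"
  where "list_sum V \<beta> xs = foldr (\<lambda>(m, n) v. \<beta> m n \<oplus>\<^bsub>V\<^esub> v) xs \<zero>\<^bsub>V\<^esub>"

lemma list_sum_Nil [simp]: "list_sum V \<beta> [] = \<zero>\<^bsub>V\<^esub>"
  and list_sum_Cons [simp]: "list_sum V \<beta> ((m, n) # xs) = \<beta> m n \<oplus>\<^bsub>V\<^esub> list_sum V \<beta> xs"
  by (simp_all add: list_sum_def)

lemma sweedler_eq_list_sum: "sweedler V t \<beta> = list_sum V \<beta> (SOME xs. xs \<in> t)"
  by (simp add: sweedler_def list_sum_def)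

lemma list_sum_closed:
  assumes "module K V" "set xs \<subseteq> A \<times> B" "\<And>m n. \<lbrakk>m \<in> A; n \<in> B\<rbrakk> \<Longrightarrow> \<beta> m n \<in> carrier V"
  shows "list_sum V \<beta> xs \<in> carrier V"
proof -
  interpret V: module K V by fact
  show ?thesis using assms(2,3) by (induction xs) auto
qed

lemma list_sum_append:
  assumes "module K V" "set xs \<subseteq> A \<times> B" "set ys \<subseteq> A \<times> B"
    "\<And>m n. \<lbrakk>m \<in> A; n \<in> B\<rbrakk> \<Longrightarrow> \<beta> m n \<in> carrier V"
  shows "list_sum V \<beta> (xs @ ys) = list_sum V \<beta> xs \<oplus>\<^bsub>V\<^esub> list_sum V \<beta> ys"
proof -
  interpret V: module K V by fact
  have closed: "list_sum V \<beta> zs \<in> carrier V" if "set zs \<subseteq> A \<times> B" for zs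
    using list_sum_closed[OF assms(1) that] assms(4) by blast
  show ?thesis
    using assms(2)
  proof (induction xs)
    case Nil
    then show ?case using closed[OF assms(3)] by simp
  next
    case (Cons p xs)
    then show ?case
      using closed[OF assms(3)] closed[of xs] assms(4)
      by (cases p) (auto simp: V.a_assoc)
  qed
qed

lemma list_sum_linear:
  assumes "module K V" "module K W" "linear_map K V W f" "set xs \<subseteq> A \<times> B"
    "\<And>m n. \<lbrakk>m \<in> A; n \<in> B\<rbrakk> \<Longrightarrow> \<beta> m n \<in> carrier V"
  shows "f (list_sum V \<beta> xs) = list_sum W (\<lambda>m n. f (\<beta> m n)) xs"
  using assms(4)
proof (induction xs)
  case Nil
  then show ?case by (simp add: linear_map_zero[OF assms(1-3)])
next
  case (Cons p xs)
  then have "list_sum V \<beta> xs \<in> carrier V"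
    using list_sum_closed[OF assms(1), of xs A B \<beta>] assms(5) by auto
  with Cons show ?case
    using assms(5) by (cases p) (auto simp: linear_map_add[OF assms(3)])
qed

lemma list_sum_cong:
  assumes "set xs \<subseteq> A \<times> B" "\<And>m n. \<lbrakk>m \<in> A; n \<in> B\<rbrakk> \<Longrightarrow> \<beta> m n = \<gamma> m n"
  shows "list_sum V \<beta> xs = list_sum V \<gamma> xs"
  using assms by (induction xs) auto

lemma list_sum_zero:
  assumes "module K V"
  shows "list_sum V (\<lambda>m n. \<zero>\<^bsub>V\<^esub>) xs = \<zero>\<^bsub>V\<^esub>"
proof -
  interpret V: module K V by fact
  show ?thesis by (induction xs) auto
qed

lemma list_sum_add:
  assumes "module K V" "set xs \<subseteq> A \<times> B"
    "\<And>m n. \<lbrakk>m \<in> A; n \<in> B\<rbrakk> \<Longrightarrow> \<beta> m n \<in> carrier V"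
    "\<And>m n. \<lbrakk>m \<in> A; n \<in> B\<rbrakk> \<Longrightarrow> \<gamma> m n \<in> carrier V"
  shows "list_sum V (\<lambda>m n. \<beta> m n \<oplus>\<^bsub>V\<^esub> \<gamma> m n) xs = list_sum V \<beta> xs \<oplus>\<^bsub>V\<^esub> list_sum V \<gamma> xs"
proof -
  interpret V: module K V by fact
  show ?thesis
    using assms(2)
  proof (induction xs)
    case Nil
    then show ?case by simp
  next
    case (Cons p xs)
    obtain m n where p: "p = (m, n)" by (cases p)
    have "list_sum V \<beta> xs \<in> carrier V" "list_sum V \<gamma> xs \<in> carrier V"
      using Cons.prems list_sum_closed[OF assms(1), of xs A B] assms(3,4) by auto
    with Cons show ?case
      using assms(3,4)[of m n] by (simp add: p V.a_ac)
  qed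
qed

lemma list_sum_swap:
  assumes "module K V" "set xs \<subseteq> A \<times> B" "set ys \<subseteq> C \<times> D"
    "\<And>a b c d. \<lbrakk>a \<in> A; b \<in> B; c \<in> C; d \<in> D\<rbrakk> \<Longrightarrow> \<beta> a b c d \<in> carrier V"
  shows "list_sum V (\<lambda>a b. list_sum V (\<beta> a b) ys) xs =
    list_sum V (\<lambda>c d. list_sum V (\<lambda>a b. \<beta> a b c d) xs) ys"
  using assms(2)
proof (induction xs)
  case Nil
  then show ?case by (simp add: list_sum_zero[OF assms(1)])
next
  case (Cons p xs)
  obtain a b where p: "p = (a, b)" by (cases p)
  have *: "list_sum V (\<lambda>a b. \<beta> a b c d) xs \<in> carrier V" if "c \<in> C" "d \<in> D" for c d
    using Cons.prems that assms(4) by (intro list_sum_closed[OF assms(1), of _ A B]) auto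
  have ab: "a \<in> A" "b \<in> B" using Cons.prems by (auto simp: p)
  have "list_sum V (\<beta> a b) ys \<oplus>\<^bsub>V\<^esub> list_sum V (\<lambda>c d. list_sum V (\<lambda>a b. \<beta> a b c d) xs) ys =
      list_sum V (\<lambda>c d. \<beta> a b c d \<oplus>\<^bsub>V\<^esub> list_sum V (\<lambda>a b. \<beta> a b c d) xs) ys"
    by (rule list_sum_add[OF assms(1,3), symmetric]) (use assms(4) ab * in auto)
  with Cons show ?case by (simp add: p)
qed

section \<open>The tensor product of two modules\<close>

lemma tensor_simps:
  "carrier (tensor K M N) = tensor_class K M N ` {xs. set xs \<subseteq> carrier M \<times> carrier N}"
  "\<zero>\<^bsub>tensor K M N\<^esub> = tensor_class K M N []"
  "s \<oplus>\<^bsub>tensor K M N\<^esub> t = (\<Union>xs\<in>s. \<Union>ys\<in>t. tensor_class K M N (xs @ ys))"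
  "c \<odot>\<^bsub>tensor K M N\<^esub> s = (\<Union>xs\<in>s. tensor_class K M N [(c \<odot>\<^bsub>M\<^esub> m, n). (m, n) \<leftarrow> xs])"
  "s \<otimes>\<^bsub>tensor K M N\<^esub> t = (\<Union>xs\<in>s. \<Union>ys\<in>t. tensor_class K M N
       [(a \<otimes>\<^bsub>M\<^esub> c, b \<otimes>\<^bsub>N\<^esub> d). (a, b) \<leftarrow> xs, (c, d) \<leftarrow> ys])"
  "\<one>\<^bsub>tensor K M N\<^esub> = tensor_class K M N [(\<one>\<^bsub>M\<^esub>, \<one>\<^bsub>N\<^esub>)]"
  by (simp_all add: tensor_def)

text \<open>Two modules over one commutative ring, so that their tensor product can be formed.\<close>

locale tensor_factors = M: module K M + N: module K N
  for K :: "('k, 'r) ring_scheme" and M :: "('k, 'm, 'x) module_scheme"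
    and N :: "('k, 'n, 'y) module_scheme"
begin

lemma tensor_equiv_closed:
  "tensor_equiv K M N xs ys \<Longrightarrow>
    set xs \<subseteq> carrier M \<times> carrier N \<and> set ys \<subseteq> carrier M \<times> carrier N"
  by (induction rule: tensor_equiv.induct) auto

lemma tensor_class_eq_iff:
  assumes "set xs \<subseteq> carrier M \<times> carrier N"
  shows "tensor_class K M N xs = tensor_class K M N ys \<longleftrightarrow> tensor_equiv K M N xs ys"
proof
  assume "tensor_class K M N xs = tensor_class K M N ys"
  moreover have "xs \<in> tensor_class K M N xs"
    using assms by (simp add: tensor_class_def tensor_equiv.refl)
  ultimately have "tensor_equiv K M N ys xs"
    by (simp add: tensor_class_def)
  then show "tensor_equiv K M N xs ys"
    by (rule tensor_equiv.sym)
next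
  assume "tensor_equiv K M N xs ys"
  then show "tensor_class K M N xs = tensor_class K M N ys"
    unfolding tensor_class_def by (blast intro: tensor_equiv.sym tensor_equiv.trans)
qed

lemma mem_tensor_class_self:
  "set xs \<subseteq> carrier M \<times> carrier N \<Longrightarrow> xs \<in> tensor_class K M N xs"
  by (simp add: tensor_class_def tensor_equiv.refl)

lemma tensor_class_carrier [simp]:
  "set xs \<subseteq> carrier M \<times> carrier N \<Longrightarrow> tensor_class K M N xs \<in> carrier (tensor K M N)"
  by (auto simp: tensor_simps)

lemma tensor_representative:
  assumes "t \<in> carrier (tensor K M N)"
  obtains xs where "t = tensor_class K M N xs" "set xs \<subseteq> carrier M \<times> carrier N"
  using assms by (auto simp: tensor_simps)

text \<open>A function on representatives that is constant on a class is evaluated by its union over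
  the class.\<close>

lemma UN_tensor_class:
  assumes "set xs \<subseteq> carrier M \<times> carrier N" "\<And>ys. tensor_equiv K M N xs ys \<Longrightarrow> F ys = F xs"
  shows "(\<Union>ys\<in>tensor_class K M N xs. F ys) = F xs"
proof -
  have "F ys = F xs" if "ys \<in> tensor_class K M N xs" for ys
    using that assms(2) by (simp add: tensor_class_def)
  then show ?thesis using mem_tensor_class_self[OF assms(1)] by blast
qed

lemma tensor_equiv_smult:
  assumes "c \<in> carrier K" "tensor_equiv K M N xs ys"
  shows "tensor_equiv K M N [(c \<odot>\<^bsub>M\<^esub> m, n). (m, n) \<leftarrow> xs] [(c \<odot>\<^bsub>M\<^esub> m, n). (m, n) \<leftarrow> ys]"
  using assms(2)
proof (induction rule: tensor_equiv.induct)
  case (refl xs)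
  then show ?case using assms(1) by (intro tensor_equiv.refl) auto
next
  case (sym xs ys)
  then show ?case by (intro tensor_equiv.sym[OF sym.IH])
next
  case (trans xs ys zs)
  then show ?case by (intro tensor_equiv.trans[OF trans.IH])
next
  case (append xs ys us vs)
  then show ?case by (simp add: tensor_equiv.append)
next
  case (commute xs ys)
  then show ?case using assms(1) by (simp, intro tensor_equiv.commute) auto
next
  case (zero n)
  then show ?case using assms(1) by (simp add: tensor_equiv.zero)
next
  case (add_left m m' n)
  then show ?case using assms(1) by (simp add: M.smult_r_distr tensor_equiv.add_left)
next
  case (add_right m n n')
  then show ?case using assms(1) by (simp add: tensor_equiv.add_right)
next
  case (scalar d m n)
  have "c \<odot>\<^bsub>M\<^esub> (d \<odot>\<^bsub>M\<^esub> m) = d \<odot>\<^bsub>M\<^esub> (c \<odot>\<^bsub>M\<^esub> m)"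
    using scalar assms(1) by (simp add: M.smult_assoc1[symmetric] M.R.m_comm)
  then show ?case using scalar assms(1) by (simp add: tensor_equiv.scalar)
qed

lemma tensor_class_add:
  assumes "set xs \<subseteq> carrier M \<times> carrier N" "set ys \<subseteq> carrier M \<times> carrier N"
  shows "tensor_class K M N xs \<oplus>\<^bsub>tensor K M N\<^esub> tensor_class K M N ys = tensor_class K M N (xs @ ys)"
proof -
  have 1: "(\<Union>vs\<in>tensor_class K M N ys. tensor_class K M N (us @ vs)) = tensor_class K M N (us @ ys)"
    if "set us \<subseteq> carrier M \<times> carrier N" for us
  proof (rule UN_tensor_class[OF assms(2)])
    fix vs assume "tensor_equiv K M N ys vs"
    then have "tensor_equiv K M N (us @ ys) (us @ vs)"
      by (rule tensor_equiv.append[OF tensor_equiv.refl[OF that]])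
    then show "tensor_class K M N (us @ vs) = tensor_class K M N (us @ ys)"
      using that assms(2) by (simp add: tensor_class_eq_iff[symmetric])
  qed
  have 2: "tensor_class K M N (us @ ys) = tensor_class K M N (xs @ ys)" if "tensor_equiv K M N xs us" for us
  proof -
    have "tensor_equiv K M N (xs @ ys) (us @ ys)"
      by (rule tensor_equiv.append[OF that tensor_equiv.refl[OF assms(2)]])
    then show ?thesis
      using assms by (simp add: tensor_class_eq_iff[symmetric])
  qed
  have "tensor_class K M N xs \<oplus>\<^bsub>tensor K M N\<^esub> tensor_class K M N ys =
      (\<Union>us\<in>tensor_class K M N xs. \<Union>vs\<in>tensor_class K M N ys. tensor_class K M N (us @ vs))"
    by (simp add: tensor_simps)
  also have "\<dots> = (\<Union>vs\<in>tensor_class K M N ys. tensor_class K M N (xs @ vs))"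
    by (rule UN_tensor_class[OF assms(1)]) (simp add: 1 2 assms(1) tensor_equiv_closed)
  finally show ?thesis using 1[OF assms(1)] by simp
qed

lemma tensor_class_smult:
  assumes "c \<in> carrier K" "set xs \<subseteq> carrier M \<times> carrier N"
  shows "c \<odot>\<^bsub>tensor K M N\<^esub> tensor_class K M N xs =
    tensor_class K M N [(c \<odot>\<^bsub>M\<^esub> m, n). (m, n) \<leftarrow> xs]"
  unfolding tensor_simps
proof (rule UN_tensor_class[OF assms(2)])
  fix ys assume "tensor_equiv K M N xs ys"
  from tensor_equiv_smult[OF assms(1) this]
  show "tensor_class K M N [(c \<odot>\<^bsub>M\<^esub> m, n). (m, n) \<leftarrow> ys] = tensor_class K M N [(c \<odot>\<^bsub>M\<^esub> m, n). (m, n) \<leftarrow> xs]"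
    using tensor_class_eq_iff tensor_equiv_closed by metis
qed

lemma pure_tensor_closed [simp]:
  "\<lbrakk>m \<in> carrier M; n \<in> carrier N\<rbrakk> \<Longrightarrow> pure_tensor K M N m n \<in> carrier (tensor K M N)"
  by (simp add: pure_tensor_def)

lemma tensor_class_Cons:
  assumes "m \<in> carrier M" "n \<in> carrier N" "set xs \<subseteq> carrier M \<times> carrier N"
  shows "tensor_class K M N ((m, n) # xs) =
    pure_tensor K M N m n \<oplus>\<^bsub>tensor K M N\<^esub> tensor_class K M N xs"
  using assms by (simp add: pure_tensor_def tensor_class_add)

lemma tensor_abelian_monoid: "abelian_monoid (tensor K M N)"
proof (rule abelian_monoidI)
  fix s t u
  assume "s \<in> carrier (tensor K M N)" "t \<in> carrier (tensor K M N)"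
  then obtain xs ys where *: "s = tensor_class K M N xs" "set xs \<subseteq> carrier M \<times> carrier N"
      "t = tensor_class K M N ys" "set ys \<subseteq> carrier M \<times> carrier N"
    by (metis tensor_representative)
  then show "s \<oplus>\<^bsub>tensor K M N\<^esub> t \<in> carrier (tensor K M N)"
    by (simp add: tensor_class_add)
  show "s \<oplus>\<^bsub>tensor K M N\<^esub> t = t \<oplus>\<^bsub>tensor K M N\<^esub> s"
    using * by (simp add: tensor_class_add tensor_class_eq_iff tensor_equiv.commute)
  assume "u \<in> carrier (tensor K M N)"
  then obtain zs where "u = tensor_class K M N zs" "set zs \<subseteq> carrier M \<times> carrier N"
    by (rule tensor_representative)
  with * show "(s \<oplus>\<^bsub>tensor K M N\<^esub> t) \<oplus>\<^bsub>tensor K M N\<^esub> u = s \<oplus>\<^bsub>tensor K M N\<^esub> (t \<oplus>\<^bsub>tensor K M N\<^esub> u)"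
    by (simp add: tensor_class_add)
next
  fix s assume "s \<in> carrier (tensor K M N)"
  then obtain xs where *: "s = tensor_class K M N xs" "set xs \<subseteq> carrier M \<times> carrier N"
    by (rule tensor_representative)
  then show "\<zero>\<^bsub>tensor K M N\<^esub> \<oplus>\<^bsub>tensor K M N\<^esub> s = s"
    using tensor_class_add[of "[]" xs] by (simp add: tensor_simps(2))
next
  show "\<zero>\<^bsub>tensor K M N\<^esub> \<in> carrier (tensor K M N)"
    by (auto simp: tensor_simps(1,2))
qed

lemma tensor_induct [consumes 1, case_names zero add]:
  assumes "t \<in> carrier (tensor K M N)"
    and "P \<zero>\<^bsub>tensor K M N\<^esub>"
    and "\<And>m n t. \<lbrakk>m \<in> carrier M; n \<in> carrier N; t \<in> carrier (tensor K M N); P t\<rbrakk> \<Longrightarrow>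
      P (pure_tensor K M N m n \<oplus>\<^bsub>tensor K M N\<^esub> t)"
  shows "P t"
proof -
  obtain xs where "t = tensor_class K M N xs" "set xs \<subseteq> carrier M \<times> carrier N"
    using assms(1) by (rule tensor_representative)
  moreover have "set xs \<subseteq> carrier M \<times> carrier N \<Longrightarrow> P (tensor_class K M N xs)" for xs
  proof (induction xs)
    case Nil
    then show ?case using assms(2) by (simp add: tensor_simps(2))
  next
    case (Cons p xs)
    then show ?case using assms(3) by (cases p) (simp add: tensor_class_Cons)
  qed
  ultimately show ?thesis by simp
qed

lemma pure_tensor_linear:
  shows pure_tensor_linear_left: "n \<in> carrier N \<Longrightarrow> linear_map K M (tensor K M N) (\<lambda>m. pure_tensor K M N m n)"
    and pure_tensor_linear_right: "m \<in> carrier M \<Longrightarrow> linear_map K N (tensor K M N) (\<lambda>n. pure_tensor K M N m n)"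
proof -
  have smult: "c \<odot>\<^bsub>tensor K M N\<^esub> pure_tensor K M N m n = pure_tensor K M N (c \<odot>\<^bsub>M\<^esub> m) n"
    if "c \<in> carrier K" "m \<in> carrier M" "n \<in> carrier N" for c m n
    using that by (simp add: pure_tensor_def tensor_class_smult)
  show "linear_map K M (tensor K M N) (\<lambda>m. pure_tensor K M N m n)" if "n \<in> carrier N"
    using that smult by (intro linear_mapI)
      (auto simp: pure_tensor_def tensor_class_add tensor_class_eq_iff tensor_equiv.add_left)
  have "pure_tensor K M N m (c \<odot>\<^bsub>N\<^esub> n) = pure_tensor K M N (c \<odot>\<^bsub>M\<^esub> m) n"
    if "c \<in> carrier K" "m \<in> carrier M" "n \<in> carrier N" for c m n
    using that by (simp add: pure_tensor_def tensor_class_eq_iff tensor_equiv.sym[OF tensor_equiv.scalar])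
  then show "linear_map K N (tensor K M N) (\<lambda>n. pure_tensor K M N m n)" if "m \<in> carrier M"
    using that smult by (intro linear_mapI)
      (auto simp: pure_tensor_def tensor_class_add tensor_class_eq_iff tensor_equiv.add_right)
qed

lemma pure_tensor_zero_left:
  "n \<in> carrier N \<Longrightarrow> pure_tensor K M N \<zero>\<^bsub>M\<^esub> n = \<zero>\<^bsub>tensor K M N\<^esub>"
  by (simp add: pure_tensor_def tensor_simps(2) tensor_class_eq_iff tensor_equiv.zero)

lemma tensor_module: "module K (tensor K M N)"
proof -
  interpret T: abelian_monoid "tensor K M N" by (rule tensor_abelian_monoid)
  have closed: "c \<odot>\<^bsub>tensor K M N\<^esub> t \<in> carrier (tensor K M N)"
    if c: "c \<in> carrier K" and t: "t \<in> carrier (tensor K M N)" for c t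
  proof -
    obtain xs where "t = tensor_class K M N xs" "set xs \<subseteq> carrier M \<times> carrier N"
      using t by (rule tensor_representative)
    then show ?thesis using c by (simp add: tensor_class_smult) (rule tensor_class_carrier, auto)
  qed
  have distr: "c \<odot>\<^bsub>tensor K M N\<^esub> (s \<oplus>\<^bsub>tensor K M N\<^esub> t) =
      c \<odot>\<^bsub>tensor K M N\<^esub> s \<oplus>\<^bsub>tensor K M N\<^esub> c \<odot>\<^bsub>tensor K M N\<^esub> t"
    if c: "c \<in> carrier K" and st: "s \<in> carrier (tensor K M N)" "t \<in> carrier (tensor K M N)" for c s t
  proof -
    obtain xs ys where *: "s = tensor_class K M N xs" "set xs \<subseteq> carrier M \<times> carrier N"
      "t = tensor_class K M N ys" "set ys \<subseteq> carrier M \<times> carrier N"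
      using st by (metis tensor_representative)
    have "set [(c \<odot>\<^bsub>M\<^esub> m, n). (m, n) \<leftarrow> zs] \<subseteq> carrier M \<times> carrier N"
      if "set zs \<subseteq> carrier M \<times> carrier N" for zs
      using that c by auto
    with * c show ?thesis by (simp add: tensor_class_smult tensor_class_add)
  qed
  have smult_pure: "c \<odot>\<^bsub>tensor K M N\<^esub> pure_tensor K M N m n = pure_tensor K M N (c \<odot>\<^bsub>M\<^esub> m) n"
    if "c \<in> carrier K" "m \<in> carrier M" "n \<in> carrier N" for c m n
    using linear_map_smult[OF pure_tensor_linear_left] that by fastforce
  have smult_zero: "c \<odot>\<^bsub>tensor K M N\<^esub> \<zero>\<^bsub>tensor K M N\<^esub> = \<zero>\<^bsub>tensor K M N\<^esub>" if "c \<in> carrier K" for c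
    using tensor_class_smult[OF that, of "[]"] by (simp add: tensor_simps(2))
  have zero_smult: "\<zero>\<^bsub>K\<^esub> \<odot>\<^bsub>tensor K M N\<^esub> t = \<zero>\<^bsub>tensor K M N\<^esub>" if "t \<in> carrier (tensor K M N)" for t
    using that
  proof (induction rule: tensor_induct)
    case zero
    then show ?case by (simp add: smult_zero)
  next
    case (add m n t)
    then show ?case by (simp add: distr smult_pure pure_tensor_zero_left)
  qed
  have l_distr: "(c \<oplus>\<^bsub>K\<^esub> d) \<odot>\<^bsub>tensor K M N\<^esub> t =
      c \<odot>\<^bsub>tensor K M N\<^esub> t \<oplus>\<^bsub>tensor K M N\<^esub> d \<odot>\<^bsub>tensor K M N\<^esub> t"
    if "c \<in> carrier K" "d \<in> carrier K" "t \<in> carrier (tensor K M N)" for c d t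
    using that(3)
  proof (induction rule: tensor_induct)
    case zero
    then show ?case using that by (simp add: smult_zero)
  next
    case (add m n t)
    then show ?case using that closed
      by (simp add: distr smult_pure M.smult_l_distr linear_map_add[OF pure_tensor_linear_left] T.a_ac)
  qed
  have one: "\<one>\<^bsub>K\<^esub> \<odot>\<^bsub>tensor K M N\<^esub> t = t" if "t \<in> carrier (tensor K M N)" for t
    using that by (induction rule: tensor_induct) (simp_all add: smult_zero distr smult_pure)
  have "abelian_group (tensor K M N)"
  proof (rule abelian_groupI)
    fix t assume t: "t \<in> carrier (tensor K M N)"
    \<comment> \<open>The additive inverse of \<open>t\<close> is \<open>(- 1) t\<close>.\<close>
    have "(\<ominus>\<^bsub>K\<^esub> \<one>\<^bsub>K\<^esub>) \<odot>\<^bsub>tensor K M N\<^esub> t \<oplus>\<^bsub>tensor K M N\<^esub> t =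
        (\<ominus>\<^bsub>K\<^esub> \<one>\<^bsub>K\<^esub> \<oplus>\<^bsub>K\<^esub> \<one>\<^bsub>K\<^esub>) \<odot>\<^bsub>tensor K M N\<^esub> t"
      using t by (subst l_distr) (auto simp: one)
    also have "\<dots> = \<zero>\<^bsub>tensor K M N\<^esub>"
      using t by (simp add: M.R.l_neg zero_smult)
    finally show "\<exists>y\<in>carrier (tensor K M N). y \<oplus>\<^bsub>tensor K M N\<^esub> t = \<zero>\<^bsub>tensor K M N\<^esub>"
      using closed t by auto
  qed (auto simp: T.a_ac)
  moreover have "c \<otimes>\<^bsub>K\<^esub> d \<odot>\<^bsub>tensor K M N\<^esub> t = c \<odot>\<^bsub>tensor K M N\<^esub> (d \<odot>\<^bsub>tensor K M N\<^esub> t)"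
    if "c \<in> carrier K" "d \<in> carrier K" "t \<in> carrier (tensor K M N)" for c d t
    using that(3)
  proof (induction rule: tensor_induct)
    case zero
    then show ?case using that by (simp add: smult_zero)
  next
    case (add m n t)
    then show ?case using that closed
      by (simp add: distr smult_pure M.smult_assoc1)
  qed
  ultimately show ?thesis
    by (intro moduleI M.R.is_cring) (auto simp: closed distr l_distr one)
qed

section \<open>The universal property in Sweedler notation\<close>

lemma list_sum_tensor_equiv:
  assumes "module K V" "bilinear_map K M N V \<beta>" "tensor_equiv K M N xs ys"
  shows "list_sum V \<beta> xs = list_sum V \<beta> ys"
proof -
  interpret V: module K V by fact
  note closed = bilinear_map_closed[OF assms(2)]
  have sc: "list_sum V \<beta> zs \<in> carrier V" if "set zs \<subseteq> carrier M \<times> carrier N" for zs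
    using list_sum_closed[OF assms(1) that] closed by blast
  have app: "list_sum V \<beta> (zs @ ws) = list_sum V \<beta> zs \<oplus>\<^bsub>V\<^esub> list_sum V \<beta> ws"
    if "set zs \<subseteq> carrier M \<times> carrier N" "set ws \<subseteq> carrier M \<times> carrier N" for zs ws
    using list_sum_append[OF assms(1) that] closed by blast
  show ?thesis
    using assms(3)
  proof (induction rule: tensor_equiv.induct)
    case (append xs ys us vs)
    then show ?case by (simp add: app tensor_equiv_closed)
  next
    case (commute xs ys)
    then show ?case by (simp add: app sc V.a_comm)
  next
    case (zero n)
    then show ?case
      using linear_map_zero[OF M.module_axioms assms(1) bilinear_map_left[OF assms(2)]] by simp
  next
    case (add_left m m' n)
    then show ?case
      using linear_map_add[OF bilinear_map_left[OF assms(2)]] closed by (simp add: V.a_assoc)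
  next
    case (add_right m n n')
    then show ?case
      using linear_map_add[OF bilinear_map_right[OF assms(2)]] closed by (simp add: V.a_assoc)
  next
    case (scalar c m n)
    then show ?case
      using linear_map_smult[OF bilinear_map_left[OF assms(2)]]
        linear_map_smult[OF bilinear_map_right[OF assms(2)]] by simp
  qed auto
qed

lemma some_representative:
  assumes "t \<in> carrier (tensor K M N)"
  shows some_representative_closed: "set (SOME xs. xs \<in> t) \<subseteq> carrier M \<times> carrier N"
    and tensor_class_some_representative: "tensor_class K M N (SOME xs. xs \<in> t) = t"
proof -
  obtain ys where ys: "t = tensor_class K M N ys" "set ys \<subseteq> carrier M \<times> carrier N"
    using assms by (rule tensor_representative)
  have "(SOME xs. xs \<in> t) \<in> t"
    using mem_tensor_class_self[OF ys(2)] ys(1) by (auto intro: someI)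
  then have "tensor_equiv K M N ys (SOME xs. xs \<in> t)"
    using ys(1) by (simp add: tensor_class_def)
  then show "set (SOME xs. xs \<in> t) \<subseteq> carrier M \<times> carrier N"
      "tensor_class K M N (SOME xs. xs \<in> t) = t"
    using tensor_equiv_closed[of ys "SOME xs. xs \<in> t"]
      tensor_class_eq_iff[OF ys(2), of "SOME xs. xs \<in> t"] ys(1) by simp_all
qed

lemma sweedler_tensor_class:
  assumes "module K V" "bilinear_map K M N V \<beta>" "set xs \<subseteq> carrier M \<times> carrier N"
  shows "sweedler V (tensor_class K M N xs) \<beta> = list_sum V \<beta> xs"
proof -
  have "tensor_equiv K M N xs (SOME ys. ys \<in> tensor_class K M N xs)"
    using tensor_class_some_representative[OF tensor_class_carrier[OF assms(3)]]
    by (simp flip: tensor_class_eq_iff[OF assms(3)])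
  from list_sum_tensor_equiv[OF assms(1,2) this] show ?thesis
    by (simp add: sweedler_eq_list_sum)
qed

lemma sweedler_closed:
  assumes "t \<in> carrier (tensor K M N)" "module K V"
    "\<And>m n. \<lbrakk>m \<in> carrier M; n \<in> carrier N\<rbrakk> \<Longrightarrow> \<beta> m n \<in> carrier V"
  shows "sweedler V t \<beta> \<in> carrier V"
  unfolding sweedler_eq_list_sum
  by (rule list_sum_closed[OF assms(2) some_representative_closed[OF assms(1)] assms(3)])

lemma sweedler_cong:
  assumes "t \<in> carrier (tensor K M N)"
    "\<And>m n. \<lbrakk>m \<in> carrier M; n \<in> carrier N\<rbrakk> \<Longrightarrow> \<beta> m n = \<gamma> m n"
  shows "sweedler V t \<beta> = sweedler V t \<gamma>"
  unfolding sweedler_eq_list_sum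
  by (rule list_sum_cong[OF some_representative_closed[OF assms(1)] assms(2)])

lemma sweedler_add:
  assumes "t \<in> carrier (tensor K M N)" "module K V"
    "\<And>m n. \<lbrakk>m \<in> carrier M; n \<in> carrier N\<rbrakk> \<Longrightarrow> \<beta> m n \<in> carrier V"
    "\<And>m n. \<lbrakk>m \<in> carrier M; n \<in> carrier N\<rbrakk> \<Longrightarrow> \<gamma> m n \<in> carrier V"
  shows "sweedler V t (\<lambda>m n. \<beta> m n \<oplus>\<^bsub>V\<^esub> \<gamma> m n) = sweedler V t \<beta> \<oplus>\<^bsub>V\<^esub> sweedler V t \<gamma>"
  unfolding sweedler_eq_list_sum
  by (rule list_sum_add[OF assms(2) some_representative_closed[OF assms(1)] assms(3,4)])

lemma linear_map_sweedler:
  assumes "t \<in> carrier (tensor K M N)" "module K V" "module K W" "linear_map K V W f"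
    "\<And>m n. \<lbrakk>m \<in> carrier M; n \<in> carrier N\<rbrakk> \<Longrightarrow> \<beta> m n \<in> carrier V"
  shows "f (sweedler V t \<beta>) = sweedler W t (\<lambda>m n. f (\<beta> m n))"
  unfolding sweedler_eq_list_sum
  by (rule list_sum_linear[OF assms(2-4) some_representative_closed[OF assms(1)] assms(5)])

lemma smult_linear:
  assumes "module K V" "c \<in> carrier K"
  shows "linear_map K V V (\<lambda>v. c \<odot>\<^bsub>V\<^esub> v)"
proof -
  interpret V: module K V by fact
  show ?thesis using assms(2)
    by (intro linear_mapI) (auto simp: V.smult_r_distr V.smult_assoc1[symmetric] M.R.m_comm)
qed

text \<open>The value of the linear map induced by \<open>\<beta> x\<close> at a fixed tensor is linear in \<open>x\<close> as
  soon as every \<open>\<beta> x m n\<close> is; no bilinearity in \<open>m\<close> and \<open>n\<close> is involved.\<close>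

lemma sweedler_linear_parameter:
  assumes "t \<in> carrier (tensor K M N)" "module K V"
    "\<And>m n. \<lbrakk>m \<in> carrier M; n \<in> carrier N\<rbrakk> \<Longrightarrow> linear_map K X V (\<lambda>x. \<beta> x m n)"
  shows "linear_map K X V (\<lambda>x. sweedler V t (\<beta> x))"
proof (rule linear_mapI)
  fix x y assume xy: "x \<in> carrier X" "y \<in> carrier X"
  show "sweedler V t (\<beta> x) \<in> carrier V"
    using assms(3) xy by (auto intro!: sweedler_closed[OF assms(1,2)] linear_map_closed[OF assms(3)])
  have "sweedler V t (\<beta> (x \<oplus>\<^bsub>X\<^esub> y)) = sweedler V t (\<lambda>m n. \<beta> x m n \<oplus>\<^bsub>V\<^esub> \<beta> y m n)"
    using linear_map_add[OF assms(3)] xy by (intro sweedler_cong[OF assms(1)]) simp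
  then show "sweedler V t (\<beta> (x \<oplus>\<^bsub>X\<^esub> y)) = sweedler V t (\<beta> x) \<oplus>\<^bsub>V\<^esub> sweedler V t (\<beta> y)"
    using linear_map_closed[OF assms(3)] xy by (simp add: sweedler_add[OF assms(1,2)])
next
  fix c x assume cx: "c \<in> carrier K" "x \<in> carrier X"
  have "sweedler V t (\<beta> (c \<odot>\<^bsub>X\<^esub> x)) = sweedler V t (\<lambda>m n. c \<odot>\<^bsub>V\<^esub> \<beta> x m n)"
    using linear_map_smult[OF assms(3)] cx by (intro sweedler_cong[OF assms(1)]) simp
  also have "\<dots> = c \<odot>\<^bsub>V\<^esub> sweedler V t (\<beta> x)"
    using linear_map_closed[OF assms(3)] cx
    by (subst linear_map_sweedler[OF assms(1,2,2) smult_linear[OF assms(2) cx(1)]]) auto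
  finally show "sweedler V t (\<beta> (c \<odot>\<^bsub>X\<^esub> x)) = c \<odot>\<^bsub>V\<^esub> sweedler V t (\<beta> x)" .
qed

lemma sweedler_pure_tensor:
  assumes "module K V" "bilinear_map K M N V \<beta>" "m \<in> carrier M" "n \<in> carrier N"
  shows "sweedler V (pure_tensor K M N m n) \<beta> = \<beta> m n"
proof -
  interpret V: module K V by fact
  show ?thesis
    using assms bilinear_map_closed[OF assms(2)]
    by (simp add: pure_tensor_def sweedler_tensor_class[OF assms(1,2)])
qed

text \<open>The existence part of the universal property: a bilinear map induces a linear map on the
  tensor product; with \<open>sweedler_pure_tensor\<close> it has the prescribed values on pure tensors.\<close>

lemma sweedler_linear:
  assumes "module K V" "bilinear_map K M N V \<beta>"
  shows "linear_map K (tensor K M N) V (\<lambda>t. sweedler V t \<beta>)"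
proof (rule linear_mapI)
  note closed = bilinear_map_closed[OF assms(2)]
  interpret V: module K V by fact
  fix s assume s: "s \<in> carrier (tensor K M N)"
  show "sweedler V s \<beta> \<in> carrier V"
    using s by (rule sweedler_closed[OF _ assms(1) closed])
  obtain xs where xs: "s = tensor_class K M N xs" "set xs \<subseteq> carrier M \<times> carrier N"
    using s by (rule tensor_representative)
  {
    fix t assume "t \<in> carrier (tensor K M N)"
    then obtain ys where ys: "t = tensor_class K M N ys" "set ys \<subseteq> carrier M \<times> carrier N"
      by (rule tensor_representative)
    show "sweedler V (s \<oplus>\<^bsub>tensor K M N\<^esub> t) \<beta> = sweedler V s \<beta> \<oplus>\<^bsub>V\<^esub> sweedler V t \<beta>"
      using xs ys list_sum_append[OF assms(1) xs(2) ys(2) closed]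
      by (simp add: tensor_class_add sweedler_tensor_class[OF assms])
  next
    fix c assume c: "c \<in> carrier K"
    have "set [(c \<odot>\<^bsub>M\<^esub> m, n). (m, n) \<leftarrow> xs] \<subseteq> carrier M \<times> carrier N"
      using xs(2) c by auto
    then have "sweedler V (c \<odot>\<^bsub>tensor K M N\<^esub> s) \<beta> = list_sum V \<beta> [(c \<odot>\<^bsub>M\<^esub> m, n). (m, n) \<leftarrow> xs]"
      using xs c by (simp add: tensor_class_smult sweedler_tensor_class[OF assms])
    also have "\<dots> = list_sum V (\<lambda>m n. c \<odot>\<^bsub>V\<^esub> \<beta> m n) xs"
      using xs(2) linear_map_smult[OF bilinear_map_left[OF assms(2)] c] by (induction xs) auto
    also have "\<dots> = c \<odot>\<^bsub>V\<^esub> list_sum V \<beta> xs"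
      by (rule list_sum_linear[OF assms(1,1) smult_linear[OF assms(1) c] xs(2) closed, symmetric])
    also have "\<dots> = c \<odot>\<^bsub>V\<^esub> sweedler V s \<beta>"
      using xs by (simp add: sweedler_tensor_class[OF assms])
    finally show "sweedler V (c \<odot>\<^bsub>tensor K M N\<^esub> s) \<beta> = c \<odot>\<^bsub>V\<^esub> sweedler V s \<beta>" .
  }
qed

lemma list_sum_pure_tensor:
  "set xs \<subseteq> carrier M \<times> carrier N \<Longrightarrow>
    list_sum (tensor K M N) (\<lambda>m n. pure_tensor K M N m n) xs = tensor_class K M N xs"
proof (induction xs)
  case Nil
  then show ?case by (simp add: tensor_simps)
next
  case (Cons p xs)
  then show ?case by (cases p) (simp add: tensor_class_Cons)
qed

lemma sweedler_pure_tensor_self: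
  assumes "t \<in> carrier (tensor K M N)"
  shows "sweedler (tensor K M N) t (\<lambda>m n. pure_tensor K M N m n) = t"
  by (simp add: sweedler_eq_list_sum list_sum_pure_tensor assms some_representative)

end

lemma sweedler_swap:
  assumes "tensor_factors K M N" "tensor_factors K P Q" "module K V"
    "s \<in> carrier (tensor K M N)" "t \<in> carrier (tensor K P Q)"
    "\<And>m n p q. \<lbrakk>m \<in> carrier M; n \<in> carrier N; p \<in> carrier P; q \<in> carrier Q\<rbrakk> \<Longrightarrow> \<beta> m n p q \<in> carrier V"
  shows "sweedler V s (\<lambda>m n. sweedler V t (\<beta> m n)) = sweedler V t (\<lambda>p q. sweedler V s (\<lambda>m n. \<beta> m n p q))"
  unfolding sweedler_eq_list_sum
  by (rule list_sum_swap[OF assms(3) tensor_factors.some_representative_closed[OF assms(1,4)]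
        tensor_factors.some_representative_closed[OF assms(2,5)] assms(6)])

text \<open>Linearity of an expression in one variable is established by following its syntax with the
  introduction rules below.\<close>

declare tensor_factors.intro [simp] tensor_factors.tensor_module [simp]

lemma linear_map_pure_tensor_left:
  assumes "linear_map K X M f" "tensor_factors K M N" "n \<in> carrier N"
  shows "linear_map K X (tensor K M N) (\<lambda>x. pure_tensor K M N (f x) n)"
  using linear_map_compose[OF tensor_factors.pure_tensor_linear_left[OF assms(2,3)] assms(1)] .

lemma linear_map_pure_tensor_right:
  assumes "linear_map K X N f" "tensor_factors K M N" "m \<in> carrier M"
  shows "linear_map K X (tensor K M N) (\<lambda>x. pure_tensor K M N m (f x))"
  using linear_map_compose[OF tensor_factors.pure_tensor_linear_right[OF assms(2,3)] assms(1)] .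

lemma linear_map_sweedler_argument:
  assumes "linear_map K X (tensor K M N) f" "tensor_factors K M N" "module K V"
    "\<And>m. m \<in> carrier M \<Longrightarrow> linear_map K N V (\<lambda>n. \<beta> m n)"
    "\<And>n. n \<in> carrier N \<Longrightarrow> linear_map K M V (\<lambda>m. \<beta> m n)"
  shows "linear_map K X V (\<lambda>x. sweedler V (f x) \<beta>)"
  using linear_map_compose[OF tensor_factors.sweedler_linear[OF assms(2,3) bilinear_mapI[OF assms(4,5)]] assms(1)] .

lemma linear_map_sweedler_parameter:
  assumes "t \<in> carrier (tensor K M N)" "tensor_factors K M N" "module K V"
    "\<And>m n. \<lbrakk>m \<in> carrier M; n \<in> carrier N\<rbrakk> \<Longrightarrow> linear_map K X V (\<lambda>x. \<beta> x m n)"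
  shows "linear_map K X V (\<lambda>x. sweedler V t (\<lambda>m n. \<beta> x m n))"
  using tensor_factors.sweedler_linear_parameter[OF assms(2,1,3,4)] .

lemma linear_map_smult_right:
  assumes "linear_map K X V f" "module K V" "c \<in> carrier K"
  shows "linear_map K X V (\<lambda>x. c \<odot>\<^bsub>V\<^esub> f x)"
proof -
  have "tensor_factors K V V" using assms(2) by simp
  from tensor_factors.smult_linear[OF this assms(2,3)]
  show ?thesis using assms(1) by (rule linear_map_compose)
qed

text \<open>Substituting \<open>t = \<Sum> \<gamma> p q\<close> into a sum over the components of \<open>t\<close>.\<close>

lemma sweedler_sweedler:
  assumes "tensor_factors K M N" "tensor_factors K P Q" "module K V"
    "t \<in> carrier (tensor K P Q)"
    "\<And>p q. \<lbrakk>p \<in> carrier P; q \<in> carrier Q\<rbrakk> \<Longrightarrow> \<gamma> p q \<in> carrier (tensor K M N)"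
    "bilinear_map K M N V \<beta>"
  shows "sweedler V (sweedler (tensor K M N) t \<gamma>) \<beta> = sweedler V t (\<lambda>p q. sweedler V (\<gamma> p q) \<beta>)"
  by (rule tensor_factors.linear_map_sweedler[OF assms(2,4) tensor_factors.tensor_module[OF assms(1)]
        assms(3) tensor_factors.sweedler_linear[OF assms(1,3,6)] assms(5)])

lemma sweedler_sweedler_pure:
  assumes "tensor_factors K M N" "tensor_factors K P Q" "module K V"
    "t \<in> carrier (tensor K P Q)"
    "\<And>p q. \<lbrakk>p \<in> carrier P; q \<in> carrier Q\<rbrakk> \<Longrightarrow> f p q \<in> carrier M"
    "\<And>p q. \<lbrakk>p \<in> carrier P; q \<in> carrier Q\<rbrakk> \<Longrightarrow> g p q \<in> carrier N"
    "\<And>m. m \<in> carrier M \<Longrightarrow> linear_map K N V (\<lambda>n. \<beta> m n)"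
    "\<And>n. n \<in> carrier N \<Longrightarrow> linear_map K M V (\<lambda>m. \<beta> m n)"
  shows "sweedler V (sweedler (tensor K M N) t (\<lambda>p q. pure_tensor K M N (f p q) (g p q))) \<beta> =
    sweedler V t (\<lambda>p q. \<beta> (f p q) (g p q))"
proof -
  have \<beta>: "bilinear_map K M N V \<beta>" using assms(7,8) by (rule bilinear_mapI)
  have "sweedler V (sweedler (tensor K M N) t (\<lambda>p q. pure_tensor K M N (f p q) (g p q))) \<beta> =
      sweedler V t (\<lambda>p q. sweedler V (pure_tensor K M N (f p q) (g p q)) \<beta>)"
    using assms(5,6)
    by (intro sweedler_sweedler[OF assms(1-4) _ \<beta>] tensor_factors.pure_tensor_closed[OF assms(1)]) auto
  also have "\<dots> = sweedler V t (\<lambda>p q. \<beta> (f p q) (g p q))"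
    by (rule tensor_factors.sweedler_cong[OF assms(2,4)])
      (rule tensor_factors.sweedler_pure_tensor[OF assms(1,3) \<beta> assms(5,6)])
  finally show ?thesis .
qed

lemma tensor_one: "\<one>\<^bsub>tensor K M N\<^esub> = pure_tensor K M N \<one>\<^bsub>M\<^esub> \<one>\<^bsub>N\<^esub>"
  by (simp add: tensor_simps(6) pure_tensor_def)

section \<open>The tensor square of an algebra\<close>

context assoc_algebra
begin

abbreviation AA where "AA \<equiv> tensor K A A"

lemma A_module [simp]: "module K A"
  by (rule module_axioms)

lemma linear_map_mult_left: "\<lbrakk>linear_map K X A f; y \<in> carrier A\<rbrakk> \<Longrightarrow> linear_map K X A (\<lambda>x. f x \<otimes>\<^bsub>A\<^esub> y)"
  unfolding linear_map_def by (auto simp: Pi_iff l_distr smult_mult_left)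

lemma linear_map_mult_right: "\<lbrakk>linear_map K X A f; y \<in> carrier A\<rbrakk> \<Longrightarrow> linear_map K X A (\<lambda>x. y \<otimes>\<^bsub>A\<^esub> f x)"
  unfolding linear_map_def by (auto simp: Pi_iff r_distr smult_mult_right)

lemma AA_factors [simp]: "tensor_factors K A A"
  by simp

lemma pure_AA_closed [simp]:
  "\<lbrakk>a \<in> carrier A; b \<in> carrier A\<rbrakk> \<Longrightarrow> pure_tensor K A A a b \<in> carrier AA"
  by (rule tensor_factors.pure_tensor_closed[OF AA_factors])

lemmas linear_intros = linear_map_id linear_map_pure_tensor_left linear_map_pure_tensor_right
  linear_map_mult_left linear_map_mult_right

text \<open>The product of the tensor square is defined through all pairs of representatives. They all
  give the same class, because that class is a value of the iterated induced linear map
  \<open>a \<otimes> b \<mapsto> (c \<otimes> d \<mapsto> a c \<otimes> b d)\<close>.\<close>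

lemma tensor_mult_sweedler:
  assumes "s \<in> carrier AA" "t \<in> carrier AA"
  shows "s \<otimes>\<^bsub>AA\<^esub> t = sweedler AA s (\<lambda>a b. sweedler AA t (\<lambda>c d.
    pure_tensor K A A (a \<otimes>\<^bsub>A\<^esub> c) (b \<otimes>\<^bsub>A\<^esub> d)))"
proof -
  interpret T: tensor_factors K A A by simp
  define p where "p = (\<lambda>a b c d. pure_tensor K A A (a \<otimes>\<^bsub>A\<^esub> c) (b \<otimes>\<^bsub>A\<^esub> d))"
  have val: "tensor_class K A A [(a \<otimes>\<^bsub>A\<^esub> c, b \<otimes>\<^bsub>A\<^esub> d). (a, b) \<leftarrow> xs, (c, d) \<leftarrow> ys] =
      sweedler AA s (\<lambda>a b. sweedler AA t (p a b))" (is "tensor_class K A A ?zs = _")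
    if "xs \<in> s" "ys \<in> t" for xs ys
  proof -
    have mem: "set us \<subseteq> carrier A \<times> carrier A \<and> u = tensor_class K A A us" if u: "u \<in> carrier AA" "us \<in> u" for u us
    proof -
      obtain vs where vs: "u = tensor_class K A A vs" "set vs \<subseteq> carrier A \<times> carrier A"
        using u(1) by (rule T.tensor_representative)
      then have "tensor_equiv K A A vs us" using u(2) by (simp add: tensor_class_def)
      then show ?thesis using T.tensor_class_eq_iff[OF vs(2), of us] T.tensor_equiv_closed vs(1) by auto
    qed
    have xs: "set xs \<subseteq> carrier A \<times> carrier A" "s = tensor_class K A A xs"
      and ys: "set ys \<subseteq> carrier A \<times> carrier A" "t = tensor_class K A A ys"
      using mem assms that by auto
    have inner: "sweedler AA t (p a b) = list_sum AA (p a b) ys" if "a \<in> carrier A" "b \<in> carrier A" for a b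
      unfolding ys(2) p_def using that ys(1)
      by (intro T.sweedler_tensor_class bilinear_mapI linear_intros) auto
    have "sweedler AA s (\<lambda>a b. sweedler AA t (p a b)) = list_sum AA (\<lambda>a b. sweedler AA t (p a b)) xs"
      unfolding xs(2) p_def using xs(1)
      by (intro T.sweedler_tensor_class bilinear_mapI linear_intros linear_map_sweedler_parameter[OF assms(2)]) auto
    also have "\<dots> = list_sum AA (\<lambda>a b. list_sum AA (p a b) ys) xs"
      by (rule list_sum_cong[OF xs(1) inner])
    also have "\<dots> = tensor_class K A A ?zs"
      using xs(1)
    proof (induction xs)
      case Nil
      then show ?case by (simp add: tensor_simps)
    next
      case (Cons q xs)
      obtain a b where q: "q = (a, b)" by (cases q)
      have ab: "a \<in> carrier A" "b \<in> carrier A" using Cons.prems q by auto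
      have zs: "set [(a \<otimes>\<^bsub>A\<^esub> c, b \<otimes>\<^bsub>A\<^esub> d). (c, d) \<leftarrow> vs] \<subseteq> carrier A \<times> carrier A"
        if "set vs \<subseteq> carrier A \<times> carrier A" "a \<in> carrier A" "b \<in> carrier A" for a b vs
        using that by auto
      have zs': "set [(a \<otimes>\<^bsub>A\<^esub> c, b \<otimes>\<^bsub>A\<^esub> d). (a, b) \<leftarrow> xs, (c, d) \<leftarrow> ys] \<subseteq> carrier A \<times> carrier A"
        using Cons.prems ys(1) by fastforce
      have "list_sum AA (p a b) vs = tensor_class K A A [(a \<otimes>\<^bsub>A\<^esub> c, b \<otimes>\<^bsub>A\<^esub> d). (c, d) \<leftarrow> vs]"
        if "set vs \<subseteq> carrier A \<times> carrier A" for vs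
        using that
      proof (induction vs)
        case Nil
        then show ?case by (simp add: tensor_simps)
      next
        case (Cons r vs)
        then show ?case
          using ab zs[of vs a b] by (cases r) (simp add: p_def T.tensor_class_Cons)
      qed
      then show ?case
        using Cons zs[OF ys(1) ab] zs' ys(1) by (simp add: q T.tensor_class_add)
    qed
    finally show ?thesis by simp
  qed
  have "s \<noteq> {}" "t \<noteq> {}"
    using assms T.mem_tensor_class_self by (metis T.tensor_representative empty_iff)+
  then have "(\<Union>xs\<in>s. \<Union>ys\<in>t. tensor_class K A A [(a \<otimes>\<^bsub>A\<^esub> c, b \<otimes>\<^bsub>A\<^esub> d). (a, b) \<leftarrow> xs, (c, d) \<leftarrow> ys]) =
      sweedler AA s (\<lambda>a b. sweedler AA t (p a b))"
    using val by (simp cong: SUP_cong_simp)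
  then show ?thesis by (simp add: tensor_simps(5) p_def)
qed

lemma sweedler_mult:
  assumes "s \<in> carrier AA" "t \<in> carrier AA" "module K V" "bilinear_map K A A V \<beta>"
  shows "sweedler V (s \<otimes>\<^bsub>AA\<^esub> t) \<beta> =
    sweedler V s (\<lambda>a b. sweedler V t (\<lambda>c d. \<beta> (a \<otimes>\<^bsub>A\<^esub> c) (b \<otimes>\<^bsub>A\<^esub> d)))"
proof -
  interpret T: tensor_factors K A A by simp
  have "sweedler V (s \<otimes>\<^bsub>AA\<^esub> t) \<beta> = sweedler V s (\<lambda>a b. sweedler V (sweedler AA t (\<lambda>c d.
      pure_tensor K A A (a \<otimes>\<^bsub>A\<^esub> c) (b \<otimes>\<^bsub>A\<^esub> d))) \<beta>)"
    unfolding tensor_mult_sweedler[OF assms(1,2)]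
    by (rule sweedler_sweedler[OF AA_factors AA_factors assms(3,1) _ assms(4)])
      (intro T.sweedler_closed assms; simp)
  also have "\<dots> = sweedler V s (\<lambda>a b. sweedler V t (\<lambda>c d. \<beta> (a \<otimes>\<^bsub>A\<^esub> c) (b \<otimes>\<^bsub>A\<^esub> d)))"
    using assms(4) unfolding bilinear_map_def
    by (intro T.sweedler_cong[OF assms(1)] sweedler_sweedler_pure[OF AA_factors AA_factors assms(3,2)]) auto
  finally show ?thesis .
qed

lemma tensor_monoid: "monoid AA"
proof (rule monoidI)
  interpret T: tensor_factors K A A by simp
  show one: "\<one>\<^bsub>AA\<^esub> \<in> carrier AA"
    by (simp add: tensor_one)
  fix s t u assume s: "s \<in> carrier AA"
  have "\<one>\<^bsub>AA\<^esub> \<otimes>\<^bsub>AA\<^esub> s = sweedler AA s (\<lambda>c d. pure_tensor K A A (\<one>\<^bsub>A\<^esub> \<otimes>\<^bsub>A\<^esub> c) (\<one>\<^bsub>A\<^esub> \<otimes>\<^bsub>A\<^esub> d))"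
    unfolding tensor_mult_sweedler[OF one s] unfolding tensor_one
    by (intro T.sweedler_pure_tensor bilinear_mapI linear_intros linear_map_sweedler_parameter[OF s]) auto
  also have "\<dots> = s"
    using T.sweedler_cong[OF s, of "\<lambda>c d. pure_tensor K A A (\<one>\<^bsub>A\<^esub> \<otimes>\<^bsub>A\<^esub> c) (\<one>\<^bsub>A\<^esub> \<otimes>\<^bsub>A\<^esub> d)" "pure_tensor K A A" AA]
    by (simp add: T.sweedler_pure_tensor_self[OF s])
  finally show "\<one>\<^bsub>AA\<^esub> \<otimes>\<^bsub>AA\<^esub> s = s" .
  have "s \<otimes>\<^bsub>AA\<^esub> \<one>\<^bsub>AA\<^esub> = sweedler AA s (\<lambda>a b. pure_tensor K A A a b)"
    unfolding tensor_mult_sweedler[OF s one] unfolding tensor_one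
  proof (rule T.sweedler_cong[OF s])
    fix a b assume ab: "a \<in> carrier A" "b \<in> carrier A"
    have "sweedler AA (pure_tensor K A A \<one>\<^bsub>A\<^esub> \<one>\<^bsub>A\<^esub>) (\<lambda>c d. pure_tensor K A A (a \<otimes>\<^bsub>A\<^esub> c) (b \<otimes>\<^bsub>A\<^esub> d)) =
        pure_tensor K A A (a \<otimes>\<^bsub>A\<^esub> \<one>\<^bsub>A\<^esub>) (b \<otimes>\<^bsub>A\<^esub> \<one>\<^bsub>A\<^esub>)"
      using ab by (intro T.sweedler_pure_tensor bilinear_mapI linear_intros) auto
    with ab show "sweedler AA (pure_tensor K A A \<one>\<^bsub>A\<^esub> \<one>\<^bsub>A\<^esub>)
        (\<lambda>c d. pure_tensor K A A (a \<otimes>\<^bsub>A\<^esub> c) (b \<otimes>\<^bsub>A\<^esub> d)) = pure_tensor K A A a b"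
      by simp
  qed
  then show "s \<otimes>\<^bsub>AA\<^esub> \<one>\<^bsub>AA\<^esub> = s"
    by (simp add: T.sweedler_pure_tensor_self[OF s])
  have closed: "x \<otimes>\<^bsub>AA\<^esub> y \<in> carrier AA" if "x \<in> carrier AA" "y \<in> carrier AA" for x y
    unfolding tensor_mult_sweedler[OF that]
    using that by (intro T.sweedler_closed) auto
  assume t: "t \<in> carrier AA"
  show "s \<otimes>\<^bsub>AA\<^esub> t \<in> carrier AA" using s t by (rule closed)
  assume u: "u \<in> carrier AA"
  have "s \<otimes>\<^bsub>AA\<^esub> t \<otimes>\<^bsub>AA\<^esub> u = sweedler AA s (\<lambda>a b. sweedler AA t (\<lambda>c d. sweedler AA u (\<lambda>e f.
      pure_tensor K A A (a \<otimes>\<^bsub>A\<^esub> c \<otimes>\<^bsub>A\<^esub> e) (b \<otimes>\<^bsub>A\<^esub> d \<otimes>\<^bsub>A\<^esub> f))))"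
    unfolding tensor_mult_sweedler[OF closed[OF s t] u]
    by (intro sweedler_mult[OF s t] bilinear_mapI linear_intros linear_map_sweedler_parameter[OF u]) auto
  also have "\<dots> = sweedler AA s (\<lambda>a b. sweedler AA (t \<otimes>\<^bsub>AA\<^esub> u) (\<lambda>c d.
      pure_tensor K A A (a \<otimes>\<^bsub>A\<^esub> c) (b \<otimes>\<^bsub>A\<^esub> d)))"
  proof (rule T.sweedler_cong[OF s])
    fix a b assume ab: "a \<in> carrier A" "b \<in> carrier A"
    have "sweedler AA (t \<otimes>\<^bsub>AA\<^esub> u) (\<lambda>c d. pure_tensor K A A (a \<otimes>\<^bsub>A\<^esub> c) (b \<otimes>\<^bsub>A\<^esub> d)) =
        sweedler AA t (\<lambda>c d. sweedler AA u (\<lambda>e f.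
          pure_tensor K A A (a \<otimes>\<^bsub>A\<^esub> (c \<otimes>\<^bsub>A\<^esub> e)) (b \<otimes>\<^bsub>A\<^esub> (d \<otimes>\<^bsub>A\<^esub> f))))"
      using ab by (intro sweedler_mult[OF t u] bilinear_mapI linear_intros) auto
    also have "\<dots> = sweedler AA t (\<lambda>c d. sweedler AA u (\<lambda>e f.
        pure_tensor K A A (a \<otimes>\<^bsub>A\<^esub> c \<otimes>\<^bsub>A\<^esub> e) (b \<otimes>\<^bsub>A\<^esub> d \<otimes>\<^bsub>A\<^esub> f)))"
      using ab by (intro T.sweedler_cong t u) (simp add: m_assoc)
    finally show "sweedler AA t (\<lambda>c d. sweedler AA u (\<lambda>e f.
        pure_tensor K A A (a \<otimes>\<^bsub>A\<^esub> c \<otimes>\<^bsub>A\<^esub> e) (b \<otimes>\<^bsub>A\<^esub> d \<otimes>\<^bsub>A\<^esub> f))) =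
      sweedler AA (t \<otimes>\<^bsub>AA\<^esub> u) (\<lambda>c d. pure_tensor K A A (a \<otimes>\<^bsub>A\<^esub> c) (b \<otimes>\<^bsub>A\<^esub> d))" by simp
  qed
  also have "\<dots> = s \<otimes>\<^bsub>AA\<^esub> (t \<otimes>\<^bsub>AA\<^esub> u)"
    by (rule tensor_mult_sweedler[OF s closed[OF t u], symmetric])
  finally show "s \<otimes>\<^bsub>AA\<^esub> t \<otimes>\<^bsub>AA\<^esub> u = s \<otimes>\<^bsub>AA\<^esub> (t \<otimes>\<^bsub>AA\<^esub> u)" .
qed

end

section \<open>Quasitriangular Hopf algebras\<close>

context hopf_algebra
begin

abbreviation HH where "HH \<equiv> tensor K H H"

lemma comult_closed [simp]: "h \<in> carrier H \<Longrightarrow> comult H h \<in> carrier HH"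
  using comult_linear by (rule linear_map_closed)

lemma linear_map_comult: "linear_map K X H f \<Longrightarrow> linear_map K X HH (\<lambda>x. comult H (f x))"
  by (rule linear_map_compose[OF comult_linear])

lemmas linear_map_sweedler_comult = linear_map_sweedler_argument[OF linear_map_comult AA_factors]

lemma counit_in_field [simp]: "h \<in> carrier H \<Longrightarrow> counit H h \<in> carrier K"
  using counit_closed by auto

lemma linear_map_counit_smult:
  assumes "linear_map K X H f" "module K V" "v \<in> carrier V"
  shows "linear_map K X V (\<lambda>x. counit H (f x) \<odot>\<^bsub>V\<^esub> v)"
proof -
  interpret V: module K V by fact
  have "linear_map K H V (\<lambda>h. counit H h \<odot>\<^bsub>V\<^esub> v)"
    using assms(3) counit_closed ring_hom_add[OF counit_hom]
    by (intro linear_mapI) (auto simp: Pi_iff V.smult_l_distr V.smult_assoc1 counit_smult)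
  then show ?thesis using assms(1) by (rule linear_map_compose)
qed

end

context quasitriangular_hopf_algebra
begin

lemma R_closed [simp]: "R \<in> carrier HH"
  using R_invertible by (simp add: Units_def)

lemmas hopf_linear_intros = linear_intros linear_map_comult linear_map_sweedler_comult
  linear_map_counit_smult linear_map_smult_right
  linear_map_sweedler_parameter[OF R_closed AA_factors]
  linear_map_sweedler_parameter[OF comult_closed AA_factors]

text \<open>The axiom \<open>R\<^sup>1 \<otimes> \<Delta>(R\<^sup>2) = R\<^sup>1 r\<^sup>1 \<otimes> r\<^sup>2 \<otimes> R\<^sup>2\<close> is an equation in \<open>H \<otimes> (H \<otimes> H)\<close>.
  It is applied through the linear map that a trilinear map induces on this module.\<close>

lemma R_comult_right_trilinear:
  assumes V: "module K V"
    and \<tau>: "\<And>b c. \<lbrakk>b \<in> carrier H; c \<in> carrier H\<rbrakk> \<Longrightarrow> linear_map K H V (\<lambda>a. \<tau> a b c)"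
      "\<And>a c. \<lbrakk>a \<in> carrier H; c \<in> carrier H\<rbrakk> \<Longrightarrow> linear_map K H V (\<lambda>b. \<tau> a b c)"
      "\<And>a b. \<lbrakk>a \<in> carrier H; b \<in> carrier H\<rbrakk> \<Longrightarrow> linear_map K H V (\<lambda>c. \<tau> a b c)"
  shows "sweedler V R (\<lambda>R1 R2. sweedler V (comult H R2) (\<lambda>a b. \<tau> R1 a b)) =
    sweedler V R (\<lambda>R1 R2. sweedler V R (\<lambda>r1 r2. \<tau> (R1 \<otimes>\<^bsub>H\<^esub> r1) r2 R2))"
proof -
  interpret T: tensor_factors K H H by simp
  interpret T3: tensor_factors K H HH by simp
  let ?T3 = "tensor K H HH"
  \<comment> \<open>the linear map with \<open>a \<otimes> (b \<otimes> c) \<mapsto> \<tau> a b c\<close>\<close>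
  let ?F = "\<lambda>t. sweedler V t (\<lambda>a u. sweedler V u (\<lambda>b c. \<tau> a b c))"
  have bil: "bilinear_map K H HH V (\<lambda>a u. sweedler V u (\<lambda>b c. \<tau> a b c))"
    using V \<tau> by (intro bilinear_mapI linear_map_sweedler_parameter[OF _ AA_factors]
        linear_map_sweedler_argument[OF linear_map_id AA_factors]) auto
  have linF: "linear_map K ?T3 V ?F"
    by (rule T3.sweedler_linear[OF V bil])
  have F_pure: "?F (pure_tensor K H HH a u) = sweedler V u (\<lambda>b c. \<tau> a b c)"
    if "a \<in> carrier H" "u \<in> carrier HH" for a u
    using that by (rule T3.sweedler_pure_tensor[OF V bil])
  have F_sw: "?F (sweedler ?T3 R \<gamma>) = sweedler V R (\<lambda>R1 R2. ?F (\<gamma> R1 R2))"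
    if "\<And>a b. \<lbrakk>a \<in> carrier H; b \<in> carrier H\<rbrakk> \<Longrightarrow> \<gamma> a b \<in> carrier ?T3" for \<gamma>
    using that by (intro T.linear_map_sweedler[OF R_closed _ V linF]) auto
  have "?F (sweedler ?T3 R (\<lambda>R1 R2. pure_tensor K H HH R1 (comult H R2))) =
      sweedler V R (\<lambda>R1 R2. ?F (pure_tensor K H HH R1 (comult H R2)))"
    by (rule F_sw) simp
  also have "\<dots> = sweedler V R (\<lambda>R1 R2. sweedler V (comult H R2) (\<lambda>a b. \<tau> R1 a b))"
    by (intro T.sweedler_cong R_closed F_pure) simp_all
  finally have l: "?F (sweedler ?T3 R (\<lambda>R1 R2. pure_tensor K H HH R1 (comult H R2))) = \<dots>" .
  have "?F (sweedler ?T3 R (\<lambda>R1 R2. sweedler ?T3 R (\<lambda>r1 r2.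
        pure_tensor K H HH (R1 \<otimes>\<^bsub>H\<^esub> r1) (pure_tensor K H H r2 R2)))) =
      sweedler V R (\<lambda>R1 R2. ?F (sweedler ?T3 R (\<lambda>r1 r2.
        pure_tensor K H HH (R1 \<otimes>\<^bsub>H\<^esub> r1) (pure_tensor K H H r2 R2))))"
    by (rule F_sw, rule T.sweedler_closed[OF R_closed]) simp_all
  also have "\<dots> = sweedler V R (\<lambda>R1 R2. sweedler V R (\<lambda>r1 r2. \<tau> (R1 \<otimes>\<^bsub>H\<^esub> r1) r2 R2))"
  proof (rule T.sweedler_cong[OF R_closed])
    fix a b assume ab: "a \<in> carrier H" "b \<in> carrier H"
    have "?F (sweedler ?T3 R (\<lambda>r1 r2. pure_tensor K H HH (a \<otimes>\<^bsub>H\<^esub> r1) (pure_tensor K H H r2 b))) =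
        sweedler V R (\<lambda>r1 r2. ?F (pure_tensor K H HH (a \<otimes>\<^bsub>H\<^esub> r1) (pure_tensor K H H r2 b)))"
      using ab by (intro F_sw) simp
    also have "\<dots> = sweedler V R (\<lambda>r1 r2. \<tau> (a \<otimes>\<^bsub>H\<^esub> r1) r2 b)"
    proof (rule T.sweedler_cong[OF R_closed])
      fix c d assume cd: "c \<in> carrier H" "d \<in> carrier H"
      show "?F (pure_tensor K H HH (a \<otimes>\<^bsub>H\<^esub> c) (pure_tensor K H H d b)) = \<tau> (a \<otimes>\<^bsub>H\<^esub> c) d b"
        using ab cd \<tau> by (simp add: F_pure) (intro T.sweedler_pure_tensor V bilinear_mapI; simp)
    qed
    finally show "?F (sweedler ?T3 R (\<lambda>r1 r2. pure_tensor K H HH (a \<otimes>\<^bsub>H\<^esub> r1) (pure_tensor K H H r2 b))) = \<dots>" .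
  qed
  finally show ?thesis using l by (simp only: R_comult_right)
qed

lemma sweedler_flip:
  assumes "t \<in> carrier HH" "module K V" "bilinear_map K H H V \<beta>"
  shows "sweedler V (tensor_flip K H H t) \<beta> = sweedler V t (\<lambda>a b. \<beta> b a)"
  unfolding tensor_flip_def using assms unfolding bilinear_map_def
  by (intro sweedler_sweedler_pure[of K H H H H]) auto

lemma tensor_flip_closed: "t \<in> carrier HH \<Longrightarrow> tensor_flip K H H t \<in> carrier HH"
  unfolding tensor_flip_def by (intro tensor_factors.sweedler_closed[of K H H]) auto

text \<open>The axiom \<open>\<Delta>\<^sup>c\<^sup>o\<^sup>p(h) R = R \<Delta>(h)\<close>, evaluated under a bilinear map.\<close>

lemma R_cop_bilinear:
  assumes V: "module K V" and h: "h \<in> carrier H" and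
    \<beta>: "\<And>a. a \<in> carrier H \<Longrightarrow> linear_map K H V (\<lambda>b. \<beta> a b)"
      "\<And>b. b \<in> carrier H \<Longrightarrow> linear_map K H V (\<lambda>a. \<beta> a b)"
  shows "sweedler V (comult H h) (\<lambda>h1 h2. sweedler V R (\<lambda>R1 R2. \<beta> (h2 \<otimes>\<^bsub>H\<^esub> R1) (h1 \<otimes>\<^bsub>H\<^esub> R2))) =
    sweedler V (comult H h) (\<lambda>h1 h2. sweedler V R (\<lambda>R1 R2. \<beta> (R1 \<otimes>\<^bsub>H\<^esub> h1) (R2 \<otimes>\<^bsub>H\<^esub> h2)))"
proof -
  have closed: "\<beta> a b \<in> carrier V" if "a \<in> carrier H" "b \<in> carrier H" for a b
    using linear_map_closed[OF \<beta>(1)] that by blast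
  have bil: "bilinear_map K H H V \<beta>" using \<beta> by (rule bilinear_mapI)
  have lin: "linear_map K H V (\<lambda>x. \<beta> a (f x))" if "linear_map K H H f" "a \<in> carrier H" for a f
    using linear_map_compose[OF \<beta>(1) that(1)] that(2) .
  have lin': "linear_map K H V (\<lambda>x. \<beta> (f x) b)" if "linear_map K H H f" "b \<in> carrier H" for b f
    using linear_map_compose[OF \<beta>(2) that(1)] that(2) .
  have "sweedler V (comult H h) (\<lambda>h1 h2. sweedler V R (\<lambda>R1 R2. \<beta> (h2 \<otimes>\<^bsub>H\<^esub> R1) (h1 \<otimes>\<^bsub>H\<^esub> R2))) =
      sweedler V (tensor_flip K H H (comult H h)) (\<lambda>h2 h1. sweedler V R (\<lambda>R1 R2. \<beta> (h2 \<otimes>\<^bsub>H\<^esub> R1) (h1 \<otimes>\<^bsub>H\<^esub> R2)))"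
    using h V by (intro sweedler_flip[symmetric] bilinear_mapI hopf_linear_intros lin lin') auto
  also have "\<dots> = sweedler V (tensor_flip K H H (comult H h) \<otimes>\<^bsub>HH\<^esub> R) \<beta>"
    using h V by (intro sweedler_mult[symmetric] bil tensor_flip_closed) auto
  also have "\<dots> = sweedler V (R \<otimes>\<^bsub>HH\<^esub> comult H h) \<beta>"
    using h by (simp add: R_cop)
  also have "\<dots> = sweedler V R (\<lambda>R1 R2. sweedler V (comult H h) (\<lambda>h1 h2. \<beta> (R1 \<otimes>\<^bsub>H\<^esub> h1) (R2 \<otimes>\<^bsub>H\<^esub> h2)))"
    using h V by (intro sweedler_mult bil) auto
  also have "\<dots> = sweedler V (comult H h) (\<lambda>h1 h2. sweedler V R (\<lambda>R1 R2. \<beta> (R1 \<otimes>\<^bsub>H\<^esub> h1) (R2 \<otimes>\<^bsub>H\<^esub> h2)))"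
    using h V closed by (intro sweedler_swap[of K H H H H]) auto
  finally show ?thesis .
qed

end

context triangular_hopf_algebra
begin

text \<open>Triangularity says that \<open>R\<^sub>2\<^sub>1 R = 1 \<otimes> 1\<close>, where \<open>R\<^sub>2\<^sub>1 = R\<^sup>2 \<otimes> R\<^sup>1\<close>. That the inverse in the
  tensor square is a two-sided inverse depends on associativity there.\<close>

lemma R_flip_mult: "tensor_flip K H H R \<otimes>\<^bsub>tensor K H H\<^esub> R = \<one>\<^bsub>tensor K H H\<^esub>"
  using monoid.Units_l_inv[OF tensor_monoid R_invertible] by (simp add: R_triangular)

lemma R_flip_bilinear:
  assumes V: "module K V" and
    \<beta>: "\<And>a. a \<in> carrier H \<Longrightarrow> linear_map K H V (\<lambda>b. \<beta> a b)"
      "\<And>b. b \<in> carrier H \<Longrightarrow> linear_map K H V (\<lambda>a. \<beta> a b)"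
  shows "sweedler V R (\<lambda>R1 R2. sweedler V R (\<lambda>r1 r2. \<beta> (R2 \<otimes>\<^bsub>H\<^esub> r1) (R1 \<otimes>\<^bsub>H\<^esub> r2))) = \<beta> \<one>\<^bsub>H\<^esub> \<one>\<^bsub>H\<^esub>"
proof -
  have bil: "bilinear_map K H H V \<beta>" using \<beta> by (rule bilinear_mapI)
  have lin: "linear_map K H V (\<lambda>x. \<beta> a (f x))" if "linear_map K H H f" "a \<in> carrier H" for a f
    using linear_map_compose[OF \<beta>(1) that(1)] that(2) .
  have lin': "linear_map K H V (\<lambda>x. \<beta> (f x) b)" if "linear_map K H H f" "b \<in> carrier H" for b f
    using linear_map_compose[OF \<beta>(2) that(1)] that(2) .
  have "sweedler V R (\<lambda>R1 R2. sweedler V R (\<lambda>r1 r2. \<beta> (R2 \<otimes>\<^bsub>H\<^esub> r1) (R1 \<otimes>\<^bsub>H\<^esub> r2))) =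
      sweedler V (tensor_flip K H H R) (\<lambda>R2 R1. sweedler V R (\<lambda>r1 r2. \<beta> (R2 \<otimes>\<^bsub>H\<^esub> r1) (R1 \<otimes>\<^bsub>H\<^esub> r2)))"
    using V by (intro sweedler_flip[symmetric] bilinear_mapI hopf_linear_intros lin lin') auto
  also have "\<dots> = sweedler V (tensor_flip K H H R \<otimes>\<^bsub>tensor K H H\<^esub> R) \<beta>"
    using V by (intro sweedler_mult[symmetric] bil tensor_flip_closed) auto
  also have "\<dots> = \<beta> \<one>\<^bsub>H\<^esub> \<one>\<^bsub>H\<^esub>"
    unfolding R_flip_mult tensor_one
    by (rule tensor_factors.sweedler_pure_tensor[OF AA_factors V bil]) simp_all
  finally show ?thesis .
qed

end

section \<open>Bimodules with the coactions given by R\<close>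

text \<open>A bimodule and the Yetter-Drinfel'd-Long bimodule built on it are records of different types.
  The following lemmas identify their tensor products, sums and linear maps.\<close>

lemma tensor_equiv_same_module:
  fixes M :: "('k, 'm, 'x) module_scheme" and M' :: "('k, 'm, 'y) module_scheme"
    and N :: "('k, 'n, 'v) module_scheme" and N' :: "('k, 'n, 'w) module_scheme"
  assumes "tensor_equiv K M N xs ys"
    and "carrier M' = carrier M" "\<zero>\<^bsub>M'\<^esub> = \<zero>\<^bsub>M\<^esub>" "add M' = add M" "smult M' = smult M"
    and "carrier N' = carrier N" "\<zero>\<^bsub>N'\<^esub> = \<zero>\<^bsub>N\<^esub>" "add N' = add N" "smult N' = smult N"
  shows "tensor_equiv K M' N' xs ys"
  using assms(1)
proof (induction rule: tensor_equiv.induct)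
  case (refl xs)
  then show ?case by (intro tensor_equiv.refl) (simp add: assms)
next
  case (sym xs ys)
  then show ?case by (intro tensor_equiv.sym[OF sym.IH])
next
  case (trans xs ys zs)
  then show ?case by (intro tensor_equiv.trans[OF trans.IH])
next
  case (append xs ys us vs)
  then show ?case by (intro tensor_equiv.append)
next
  case (commute xs ys)
  then show ?case by (intro tensor_equiv.commute) (simp_all add: assms)
next
  case (zero n)
  then show ?case using tensor_equiv.zero[of n N' K M'] by (simp add: assms)
next
  case (add_left m m' n)
  then show ?case using tensor_equiv.add_left[of m M' m' n N' K] by (simp add: assms)
next
  case (add_right m n n')
  then show ?case using tensor_equiv.add_right[of m M' n N' n' K] by (simp add: assms)
next
  case (scalar c m n)
  then show ?case using tensor_equiv.scalar[of c K m M' n N'] by (simp add: assms)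
qed

lemma tensor_same_module:
  fixes M :: "('k, 'm, 'x) module_scheme" and M' :: "('k, 'm, 'y) module_scheme"
    and N :: "('k, 'n, 'v) module_scheme" and N' :: "('k, 'n, 'w) module_scheme"
  assumes M: "carrier M' = carrier M" "\<zero>\<^bsub>M'\<^esub> = \<zero>\<^bsub>M\<^esub>" "add M' = add M" "smult M' = smult M"
      "mult M' = mult M" "\<one>\<^bsub>M'\<^esub> = \<one>\<^bsub>M\<^esub>"
    and N: "carrier N' = carrier N" "\<zero>\<^bsub>N'\<^esub> = \<zero>\<^bsub>N\<^esub>" "add N' = add N" "smult N' = smult N"
      "mult N' = mult N" "\<one>\<^bsub>N'\<^esub> = \<one>\<^bsub>N\<^esub>"
  shows "tensor K M' N' = tensor K M N" "pure_tensor K M' N' = pure_tensor K M N"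
proof -
  have "tensor_equiv K M' N' = tensor_equiv K M N"
    using tensor_equiv_same_module[of K M N _ _ M' N'] tensor_equiv_same_module[of K M' N' _ _ M N]
    by (intro ext iffI) (simp_all add: M N)
  then have "tensor_class K M' N' = tensor_class K M N"
    by (simp add: tensor_class_def fun_eq_iff)
  then show "tensor K M' N' = tensor K M N" "pure_tensor K M' N' = pure_tensor K M N"
    by (simp_all add: tensor_def pure_tensor_def fun_eq_iff M N)
qed

lemma ydl_of_bimodule_simps [simp]:
  "carrier (ydl_of_bimodule K H R M) = carrier M"
  "\<zero>\<^bsub>ydl_of_bimodule K H R M\<^esub> = \<zero>\<^bsub>M\<^esub>"
  "\<one>\<^bsub>ydl_of_bimodule K H R M\<^esub> = \<one>\<^bsub>M\<^esub>"
  "add (ydl_of_bimodule K H R M) = add M"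
  "mult (ydl_of_bimodule K H R M) = mult M"
  "smult (ydl_of_bimodule K H R M) = smult M"
  "lact (ydl_of_bimodule K H R M) = lact M"
  "ract (ydl_of_bimodule K H R M) = ract M"
  by (simp_all add: ydl_of_bimodule_def bimodule.extend_def ydl.fields_def)

lemma tensor_ydl_of_bimodule [simp]:
  fixes N :: "('k, 'n, 'z) module_scheme"
  shows "tensor K N (ydl_of_bimodule K H R M) = tensor K N M"
    "tensor K (ydl_of_bimodule K H R M) N = tensor K M N"
    "pure_tensor K N (ydl_of_bimodule K H R M) = pure_tensor K N M"
    "pure_tensor K (ydl_of_bimodule K H R M) N = pure_tensor K M N"
  by (intro tensor_same_module; simp)+

lemma sweedler_ydl_of_bimodule [simp]:
  "sweedler (ydl_of_bimodule K H R M) = sweedler M"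
  by (simp add: sweedler_def fun_eq_iff)

lemma linear_map_ydl_of_bimodule [simp]:
  "linear_map K (ydl_of_bimodule K H R M) N = linear_map K M N"
  "linear_map K N (ydl_of_bimodule K H R M) = linear_map K N M"
  by (simp_all add: linear_map_def fun_eq_iff)

lemma bilinear_map_ydl_of_bimodule [simp]:
  "bilinear_map K (ydl_of_bimodule K H R M) N V = bilinear_map K M N V"
  "bilinear_map K N (ydl_of_bimodule K H R M) V = bilinear_map K N M V"
  "bilinear_map K N V (ydl_of_bimodule K H R M) = bilinear_map K N V M"
  by (simp_all add: bilinear_map_def fun_eq_iff)

lemma module_ydl_of_bimodule [simp]:
  assumes "module K M"
  shows "module K (ydl_of_bimodule K H R M)"
proof -
  interpret M: module K M by fact
  have "abelian_group (ydl_of_bimodule K H R M)"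
    by (rule abelian_groupI) (auto simp: M.a_ac intro: M.l_neg)
  then show ?thesis
    by (intro moduleI M.R.is_cring)
      (simp_all add: M.smult_l_distr M.smult_r_distr M.smult_assoc1)
qed

lemma bimodule_hom_ydl_of_bimodule [simp]:
  "bimodule_hom K H (ydl_of_bimodule K H R M) (ydl_of_bimodule K H R N) f = bimodule_hom K H M N f"
  by (simp add: bimodule_hom_def)

text \<open>A bimodule over a quasitriangular Hopf algebra, with the left coaction
  \<open>lco m = R\<^sup>2 \<otimes> R\<^sup>1 \<triangleright> m\<close> and the right coaction \<open>rco m = m \<triangleleft> R\<^sup>1 \<otimes> R\<^sup>2\<close>.\<close>

locale quasitriangular_bimodule = quasitriangular_hopf_algebra K H R + hopf_bimodule K H M
  for K :: "('k, 'r) ring_scheme" and H :: "('k, 'h, 'x) hopf_scheme"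
    and R :: "('h \<times> 'h) list set" and M :: "('k, 'h, 'm) bimodule"
begin

lemma M_module [simp]: "module K M"
  by (rule M.module_axioms)

lemma linear_map_lact_left: "\<lbrakk>linear_map K X H f; m \<in> carrier M\<rbrakk> \<Longrightarrow> linear_map K X M (\<lambda>x. f x \<triangleright>\<^bsub>M\<^esub> m)"
  using linear_map_compose[OF bilinear_map_left[OF lact_bilinear]] .

lemma linear_map_lact_right: "\<lbrakk>linear_map K X M f; h \<in> carrier H\<rbrakk> \<Longrightarrow> linear_map K X M (\<lambda>x. h \<triangleright>\<^bsub>M\<^esub> f x)"
  using linear_map_compose[OF bilinear_map_right[OF lact_bilinear]] .

lemma linear_map_ract_left: "\<lbrakk>linear_map K X M f; h \<in> carrier H\<rbrakk> \<Longrightarrow> linear_map K X M (\<lambda>x. f x \<triangleleft>\<^bsub>M\<^esub> h)"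
  using linear_map_compose[OF bilinear_map_left[OF ract_bilinear]] .

lemma linear_map_ract_right: "\<lbrakk>linear_map K X H f; m \<in> carrier M\<rbrakk> \<Longrightarrow> linear_map K X M (\<lambda>x. m \<triangleleft>\<^bsub>M\<^esub> f x)"
  using linear_map_compose[OF bilinear_map_right[OF ract_bilinear]] .

lemma act_closed [simp]:
  "\<lbrakk>h \<in> carrier H; m \<in> carrier M\<rbrakk> \<Longrightarrow> h \<triangleright>\<^bsub>M\<^esub> m \<in> carrier M"
  "\<lbrakk>h \<in> carrier H; m \<in> carrier M\<rbrakk> \<Longrightarrow> m \<triangleleft>\<^bsub>M\<^esub> h \<in> carrier M"
  using bilinear_map_closed[OF lact_bilinear] bilinear_map_closed[OF ract_bilinear] by auto

abbreviation lco where "lco \<equiv> lcoact (ydl_of_bimodule K H R M)"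
abbreviation rco where "rco \<equiv> rcoact (ydl_of_bimodule K H R M)"

lemma lco_def: "lco = (\<lambda>m. sweedler (tensor K H M) R (\<lambda>R1 R2. pure_tensor K H M R2 (R1 \<triangleright>\<^bsub>M\<^esub> m)))"
  and rco_def: "rco = (\<lambda>m. sweedler (tensor K M H) R (\<lambda>R1 R2. pure_tensor K M H (m \<triangleleft>\<^bsub>M\<^esub> R1) R2))"
  by (simp_all add: ydl_of_bimodule_def bimodule.extend_def ydl.fields_def)

lemmas act_linear_intros = hopf_linear_intros linear_map_lact_left linear_map_lact_right
  linear_map_ract_left linear_map_ract_right

lemma pure_closed [simp]:
  "tensor_factors K X Y \<Longrightarrow> x \<in> carrier X \<Longrightarrow> y \<in> carrier Y \<Longrightarrow> pure_tensor K X Y x y \<in> carrier (tensor K X Y)"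
  by (rule tensor_factors.pure_tensor_closed)

lemma lco_linear: "linear_map K M (tensor K H M) lco"
  unfolding lco_def by (intro act_linear_intros) auto

lemma rco_linear: "linear_map K M (tensor K M H) rco"
  unfolding rco_def by (intro act_linear_intros) auto

lemmas lco_closed [simp] = linear_map_closed[OF lco_linear]
lemmas rco_closed [simp] = linear_map_closed[OF rco_linear]

lemmas ydl_linear_intros = act_linear_intros linear_map_compose[OF lco_linear] linear_map_compose[OF rco_linear]

lemma sweedler_lco:
  assumes "module K V" "m \<in> carrier M"
    "\<And>h. h \<in> carrier H \<Longrightarrow> linear_map K M V (\<lambda>m. \<beta> h m)"
    "\<And>m. m \<in> carrier M \<Longrightarrow> linear_map K H V (\<lambda>h. \<beta> h m)"
  shows "sweedler V (lco m) \<beta> = sweedler V R (\<lambda>R1 R2. \<beta> R2 (R1 \<triangleright>\<^bsub>M\<^esub> m))"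
  unfolding lco_def using assms by (intro sweedler_sweedler_pure[of K H M H H]) auto

lemma sweedler_rco:
  assumes "module K V" "m \<in> carrier M"
    "\<And>m. m \<in> carrier M \<Longrightarrow> linear_map K H V (\<lambda>h. \<beta> m h)"
    "\<And>h. h \<in> carrier H \<Longrightarrow> linear_map K M V (\<lambda>m. \<beta> m h)"
  shows "sweedler V (rco m) \<beta> = sweedler V R (\<lambda>R1 R2. \<beta> (m \<triangleleft>\<^bsub>M\<^esub> R1) R2)"
  unfolding rco_def using assms by (intro sweedler_sweedler_pure[of K M H H H]) auto

text \<open>A linear map into which a coaction is substituted.\<close>

lemma apply_lco:
  assumes "module K V" "m \<in> carrier M" "linear_map K (tensor K H M) V f"
  shows "f (lco m) = sweedler V R (\<lambda>R1 R2. f (pure_tensor K H M R2 (R1 \<triangleright>\<^bsub>M\<^esub> m)))"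
  unfolding lco_def using assms
  by (intro tensor_factors.linear_map_sweedler[of K H H]) auto

lemma apply_rco:
  assumes "module K V" "m \<in> carrier M" "linear_map K (tensor K M H) V f"
  shows "f (rco m) = sweedler V R (\<lambda>R1 R2. f (pure_tensor K M H (m \<triangleleft>\<^bsub>M\<^esub> R1) R2))"
  unfolding rco_def using assms
  by (intro tensor_factors.linear_map_sweedler[of K H H]) auto

lemmas R_cong = tensor_factors.sweedler_cong[OF AA_factors R_closed]
lemmas \<Delta>_cong = tensor_factors.sweedler_cong[OF AA_factors comult_closed]

lemma R_swap:
  assumes "module K V"
    "\<And>a b c d. \<lbrakk>a \<in> carrier H; b \<in> carrier H; c \<in> carrier H; d \<in> carrier H\<rbrakk> \<Longrightarrow> \<beta> a b c d \<in> carrier V"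
  shows "sweedler V R (\<lambda>a b. sweedler V R (\<lambda>c d. \<beta> a b c d)) =
    sweedler V R (\<lambda>c d. sweedler V R (\<lambda>a b. \<beta> a b c d))"
  using assms by (intro sweedler_swap[of K H H H H]) auto

text \<open>Both coactions are coassociative by \<open>R\<^sup>1 \<otimes> \<Delta>(R\<^sup>2) = R\<^sup>1 r\<^sup>1 \<otimes> r\<^sup>2 \<otimes> R\<^sup>2\<close>.\<close>

lemma lco_coassoc:
  assumes m: "m \<in> carrier M"
  defines "V \<equiv> tensor K H (tensor K H M)"
  shows "sweedler V (lco m) (\<lambda>a m0. sweedler V (comult H a) (\<lambda>a1 a2.
      pure_tensor K H (tensor K H M) a1 (pure_tensor K H M a2 m0))) =
    sweedler V (lco m) (\<lambda>a m0. pure_tensor K H (tensor K H M) a (lco m0))"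
proof -
  let ?p = "\<lambda>a b n. pure_tensor K H (tensor K H M) a (pure_tensor K H M b n)"
  have V: "module K V" by (simp add: V_def)
  have "sweedler V (lco m) (\<lambda>a m0. sweedler V (comult H a) (\<lambda>a1 a2. ?p a1 a2 m0)) =
      sweedler V R (\<lambda>R1 R2. sweedler V (comult H R2) (\<lambda>a1 a2. ?p a1 a2 (R1 \<triangleright>\<^bsub>M\<^esub> m)))"
    using m unfolding V_def by (intro sweedler_lco ydl_linear_intros) auto
  also have "\<dots> = sweedler V R (\<lambda>R1 R2. sweedler V R (\<lambda>r1 r2. ?p r2 R2 ((R1 \<otimes>\<^bsub>H\<^esub> r1) \<triangleright>\<^bsub>M\<^esub> m)))"
    using m unfolding V_def by (intro R_comult_right_trilinear ydl_linear_intros) auto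
  also have "\<dots> = sweedler V R (\<lambda>r1 r2. sweedler V R (\<lambda>R1 R2. ?p r2 R2 ((R1 \<otimes>\<^bsub>H\<^esub> r1) \<triangleright>\<^bsub>M\<^esub> m)))"
    using m unfolding V_def by (intro R_swap) auto
  also have "\<dots> = sweedler V R (\<lambda>r1 r2. pure_tensor K H (tensor K H M) r2 (lco (r1 \<triangleright>\<^bsub>M\<^esub> m)))"
  proof (rule R_cong)
    fix r1 r2 assume r: "r1 \<in> carrier H" "r2 \<in> carrier H"
    have "pure_tensor K H (tensor K H M) r2 (lco (r1 \<triangleright>\<^bsub>M\<^esub> m)) =
        sweedler V R (\<lambda>R1 R2. ?p r2 R2 (R1 \<triangleright>\<^bsub>M\<^esub> (r1 \<triangleright>\<^bsub>M\<^esub> m)))"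
      using m r unfolding V_def by (intro apply_lco ydl_linear_intros) auto
    also have "\<dots> = sweedler V R (\<lambda>R1 R2. ?p r2 R2 ((R1 \<otimes>\<^bsub>H\<^esub> r1) \<triangleright>\<^bsub>M\<^esub> m))"
      using m r by (intro R_cong) (simp add: lact_mult)
    finally show "sweedler V R (\<lambda>R1 R2. ?p r2 R2 ((R1 \<otimes>\<^bsub>H\<^esub> r1) \<triangleright>\<^bsub>M\<^esub> m)) =
        pure_tensor K H (tensor K H M) r2 (lco (r1 \<triangleright>\<^bsub>M\<^esub> m))" by simp
  qed
  also have "\<dots> = sweedler V (lco m) (\<lambda>a m0. pure_tensor K H (tensor K H M) a (lco m0))"
    using m unfolding V_def by (intro sweedler_lco[symmetric] ydl_linear_intros) auto
  finally show ?thesis .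
qed


lemma rco_coassoc:
  assumes m: "m \<in> carrier M"
  defines "V \<equiv> tensor K M (tensor K H H)"
  shows "sweedler V (rco m) (\<lambda>m0 b. sweedler V (rco m0) (\<lambda>m00 b'.
      pure_tensor K M HH m00 (pure_tensor K H H b' b))) =
    sweedler V (rco m) (\<lambda>m0 b. pure_tensor K M HH m0 (comult H b))"
proof -
  let ?p = "\<lambda>n a b. pure_tensor K M HH n (pure_tensor K H H a b)"
  have V: "module K V" by (simp add: V_def)
  have lin_rco: "linear_map K X V (\<lambda>x. sweedler V (rco (f x)) (\<lambda>m00 b'. ?p m00 b' b))"
    if "linear_map K X M f" "b \<in> carrier H" for X :: "('k, 'm, 'z) module_scheme" and f b
    using that unfolding V_def
    by (intro linear_map_sweedler_argument[OF linear_map_compose[OF rco_linear]] ydl_linear_intros) auto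
  have "sweedler V (rco m) (\<lambda>m0 b. sweedler V (rco m0) (\<lambda>m00 b'. ?p m00 b' b)) =
      sweedler V R (\<lambda>R1 R2. sweedler V (rco (m \<triangleleft>\<^bsub>M\<^esub> R1)) (\<lambda>m00 b'. ?p m00 b' R2))"
  proof (rule sweedler_rco[OF V m])
    fix n assume n: "n \<in> carrier M"
    show "linear_map K H V (\<lambda>b. sweedler V (rco n) (\<lambda>m00 b'. ?p m00 b' b))"
      using n unfolding V_def
      by (intro linear_map_sweedler_parameter[of "rco n" K M H] ydl_linear_intros) auto
  qed (rule lin_rco, auto)
  also have "\<dots> = sweedler V R (\<lambda>R1 R2. sweedler V R (\<lambda>r1 r2. ?p (m \<triangleleft>\<^bsub>M\<^esub> (R1 \<otimes>\<^bsub>H\<^esub> r1)) r2 R2))"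
  proof (rule R_cong)
    fix R1 R2 assume r: "R1 \<in> carrier H" "R2 \<in> carrier H"
    have "sweedler V (rco (m \<triangleleft>\<^bsub>M\<^esub> R1)) (\<lambda>m00 b'. ?p m00 b' R2) =
        sweedler V R (\<lambda>r1 r2. ?p (m \<triangleleft>\<^bsub>M\<^esub> R1 \<triangleleft>\<^bsub>M\<^esub> r1) r2 R2)"
      using m r unfolding V_def by (intro sweedler_rco ydl_linear_intros) auto
    also have "\<dots> = sweedler V R (\<lambda>r1 r2. ?p (m \<triangleleft>\<^bsub>M\<^esub> (R1 \<otimes>\<^bsub>H\<^esub> r1)) r2 R2)"
      using m r by (intro R_cong) (simp add: ract_mult)
    finally show "sweedler V (rco (m \<triangleleft>\<^bsub>M\<^esub> R1)) (\<lambda>m00 b'. ?p m00 b' R2) = \<dots>" .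
  qed
  also have "\<dots> = sweedler V R (\<lambda>R1 R2. sweedler V (comult H R2) (\<lambda>a b. ?p (m \<triangleleft>\<^bsub>M\<^esub> R1) a b))"
    using m unfolding V_def by (intro R_comult_right_trilinear[symmetric] ydl_linear_intros) auto
  also have "\<dots> = sweedler V R (\<lambda>R1 R2. pure_tensor K M HH (m \<triangleleft>\<^bsub>M\<^esub> R1) (comult H R2))"
  proof (rule R_cong)
    fix R1 R2 assume r: "R1 \<in> carrier H" "R2 \<in> carrier H"
    have "pure_tensor K M HH (m \<triangleleft>\<^bsub>M\<^esub> R1) (sweedler HH (comult H R2) (\<lambda>a b. pure_tensor K H H a b)) =
        sweedler V (comult H R2) (\<lambda>a b. ?p (m \<triangleleft>\<^bsub>M\<^esub> R1) a b)"
      using m r unfolding V_def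
      by (intro tensor_factors.linear_map_sweedler[of K H H "comult H R2" HH] ydl_linear_intros) auto
    then show "sweedler V (comult H R2) (\<lambda>a b. ?p (m \<triangleleft>\<^bsub>M\<^esub> R1) a b) =
        pure_tensor K M HH (m \<triangleleft>\<^bsub>M\<^esub> R1) (comult H R2)"
      using tensor_factors.sweedler_pure_tensor_self[OF AA_factors comult_closed[OF r(2)]] by simp
  qed
  also have "\<dots> = sweedler V (rco m) (\<lambda>m0 b. pure_tensor K M HH m0 (comult H b))"
    using m unfolding V_def by (intro sweedler_rco[symmetric] ydl_linear_intros) auto
  finally show ?thesis .
qed

lemma lco_counit:
  assumes m: "m \<in> carrier M"
  shows "sweedler M (lco m) (\<lambda>a m0. counit H a \<odot>\<^bsub>M\<^esub> m0) = m"
proof -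
  have "sweedler M (lco m) (\<lambda>a m0. counit H a \<odot>\<^bsub>M\<^esub> m0) =
      sweedler M R (\<lambda>R1 R2. counit H R2 \<odot>\<^bsub>M\<^esub> (R1 \<triangleright>\<^bsub>M\<^esub> m))"
    using m by (intro sweedler_lco ydl_linear_intros) auto
  also have "\<dots> = sweedler M R (\<lambda>R1 R2. (counit H R2 \<odot>\<^bsub>H\<^esub> R1) \<triangleright>\<^bsub>M\<^esub> m)"
    using m by (intro R_cong) (simp add: linear_map_smult[OF bilinear_map_left[OF lact_bilinear]])
  also have "\<dots> = sweedler H R (\<lambda>R1 R2. counit H R2 \<odot>\<^bsub>H\<^esub> R1) \<triangleright>\<^bsub>M\<^esub> m"
    using m by (intro tensor_factors.linear_map_sweedler[of K H H R H, symmetric] ydl_linear_intros) auto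
  also have "\<dots> = m"
    using m by (simp add: R_counit_right lact_one)
  finally show ?thesis .
qed

lemma rco_counit:
  assumes m: "m \<in> carrier M"
  shows "sweedler M (rco m) (\<lambda>m0 b. counit H b \<odot>\<^bsub>M\<^esub> m0) = m"
proof -
  have "sweedler M (rco m) (\<lambda>m0 b. counit H b \<odot>\<^bsub>M\<^esub> m0) =
      sweedler M R (\<lambda>R1 R2. counit H R2 \<odot>\<^bsub>M\<^esub> (m \<triangleleft>\<^bsub>M\<^esub> R1))"
    using m by (intro sweedler_rco ydl_linear_intros) auto
  also have "\<dots> = sweedler M R (\<lambda>R1 R2. m \<triangleleft>\<^bsub>M\<^esub> (counit H R2 \<odot>\<^bsub>H\<^esub> R1))"
    using m by (intro R_cong) (simp add: linear_map_smult[OF bilinear_map_right[OF ract_bilinear]])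
  also have "\<dots> = m \<triangleleft>\<^bsub>M\<^esub> sweedler H R (\<lambda>R1 R2. counit H R2 \<odot>\<^bsub>H\<^esub> R1)"
    using m by (intro tensor_factors.linear_map_sweedler[of K H H R H, symmetric] ydl_linear_intros) auto
  also have "\<dots> = m"
    using m by (simp add: R_counit_right ract_one)
  finally show ?thesis .
qed

lemma lco_rco:
  assumes m: "m \<in> carrier M"
  defines "V \<equiv> tensor K H (tensor K M H)"
  shows "sweedler V (lco m) (\<lambda>a m0. pure_tensor K H (tensor K M H) a (rco m0)) =
    sweedler V (rco m) (\<lambda>m0 b. sweedler V (lco m0) (\<lambda>a m00.
      pure_tensor K H (tensor K M H) a (pure_tensor K M H m00 b)))"
proof -
  let ?p = "\<lambda>a n b. pure_tensor K H (tensor K M H) a (pure_tensor K M H n b)"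
  have V: "module K V" by (simp add: V_def)
  have lin_lco: "linear_map K X V (\<lambda>x. sweedler V (lco (f x)) (\<lambda>a n. ?p a n b))"
    if "linear_map K X M f" "b \<in> carrier H" for X :: "('k, 'm, 'z) module_scheme" and f b
    using that unfolding V_def
    by (intro linear_map_sweedler_argument[OF linear_map_compose[OF lco_linear]] ydl_linear_intros) auto
  have "sweedler V (lco m) (\<lambda>a m0. pure_tensor K H (tensor K M H) a (rco m0)) =
      sweedler V R (\<lambda>R1 R2. pure_tensor K H (tensor K M H) R2 (rco (R1 \<triangleright>\<^bsub>M\<^esub> m)))"
    using m unfolding V_def by (intro sweedler_lco ydl_linear_intros) auto
  also have "\<dots> = sweedler V R (\<lambda>R1 R2. sweedler V R (\<lambda>r1 r2. ?p R2 (R1 \<triangleright>\<^bsub>M\<^esub> m \<triangleleft>\<^bsub>M\<^esub> r1) r2))"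
    using m unfolding V_def by (intro R_cong apply_rco ydl_linear_intros) auto
  also have "\<dots> = sweedler V R (\<lambda>r1 r2. sweedler V R (\<lambda>R1 R2. ?p R2 (R1 \<triangleright>\<^bsub>M\<^esub> m \<triangleleft>\<^bsub>M\<^esub> r1) r2))"
    using m unfolding V_def by (intro R_swap) auto
  also have "\<dots> = sweedler V R (\<lambda>r1 r2. sweedler V (lco (m \<triangleleft>\<^bsub>M\<^esub> r1)) (\<lambda>a m00. ?p a m00 r2))"
  proof (rule R_cong)
    fix r1 r2 assume r: "r1 \<in> carrier H" "r2 \<in> carrier H"
    have "sweedler V (lco (m \<triangleleft>\<^bsub>M\<^esub> r1)) (\<lambda>a m00. ?p a m00 r2) =
        sweedler V R (\<lambda>R1 R2. ?p R2 (R1 \<triangleright>\<^bsub>M\<^esub> (m \<triangleleft>\<^bsub>M\<^esub> r1)) r2)"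
      using m r unfolding V_def by (intro sweedler_lco ydl_linear_intros) auto
    also have "\<dots> = sweedler V R (\<lambda>R1 R2. ?p R2 (R1 \<triangleright>\<^bsub>M\<^esub> m \<triangleleft>\<^bsub>M\<^esub> r1) r2)"
      using m r by (intro R_cong) (simp add: lact_ract)
    finally show "sweedler V R (\<lambda>R1 R2. ?p R2 (R1 \<triangleright>\<^bsub>M\<^esub> m \<triangleleft>\<^bsub>M\<^esub> r1) r2) =
        sweedler V (lco (m \<triangleleft>\<^bsub>M\<^esub> r1)) (\<lambda>a m00. ?p a m00 r2)" by simp
  qed
  also have "\<dots> = sweedler V (rco m) (\<lambda>m0 b. sweedler V (lco m0) (\<lambda>a m00. ?p a m00 b))"
  proof (rule sweedler_rco[OF V m, symmetric])
    fix n assume n: "n \<in> carrier M"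
    show "linear_map K H V (\<lambda>b. sweedler V (lco n) (\<lambda>a m00. ?p a m00 b))"
      using n unfolding V_def
      by (intro linear_map_sweedler_parameter[of "lco n" K H M] ydl_linear_intros) auto
  qed (rule lin_lco, auto)
  finally show ?thesis .
qed

text \<open>The two compatibilities between the action and the coaction on the same side are both
  instances of \<open>\<Delta>\<^sup>c\<^sup>o\<^sup>p(h) R = R \<Delta>(h)\<close>: the bilinear maps are \<open>x \<otimes> y \<mapsto> y \<otimes> x \<triangleright> m\<close> on the left
  and \<open>x \<otimes> y \<mapsto> m \<triangleleft> x \<otimes> y\<close> on the right.\<close>

lemma lact_lco:
  assumes h: "h \<in> carrier H" and m: "m \<in> carrier M"
  defines "V \<equiv> tensor K H M"
  shows "sweedler V (comult H h) (\<lambda>h1 h2. sweedler V (lco (h1 \<triangleright>\<^bsub>M\<^esub> m)) (\<lambda>a m0.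
      pure_tensor K H M (a \<otimes>\<^bsub>H\<^esub> h2) m0)) =
    sweedler V (comult H h) (\<lambda>h1 h2. sweedler V (lco m) (\<lambda>a m0.
      pure_tensor K H M (h1 \<otimes>\<^bsub>H\<^esub> a) (h2 \<triangleright>\<^bsub>M\<^esub> m0)))"
proof -
  let ?\<beta> = "\<lambda>x y. pure_tensor K H M y (x \<triangleright>\<^bsub>M\<^esub> m)"
  have "sweedler V (comult H h) (\<lambda>h1 h2. sweedler V (lco (h1 \<triangleright>\<^bsub>M\<^esub> m)) (\<lambda>a m0.
      pure_tensor K H M (a \<otimes>\<^bsub>H\<^esub> h2) m0)) =
    sweedler V (comult H h) (\<lambda>h1 h2. sweedler V R (\<lambda>R1 R2. ?\<beta> (R1 \<otimes>\<^bsub>H\<^esub> h1) (R2 \<otimes>\<^bsub>H\<^esub> h2)))"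
  proof (rule \<Delta>_cong[OF h])
    fix h1 h2 assume h12: "h1 \<in> carrier H" "h2 \<in> carrier H"
    have "sweedler V (lco (h1 \<triangleright>\<^bsub>M\<^esub> m)) (\<lambda>a m0. pure_tensor K H M (a \<otimes>\<^bsub>H\<^esub> h2) m0) =
        sweedler V R (\<lambda>R1 R2. pure_tensor K H M (R2 \<otimes>\<^bsub>H\<^esub> h2) (R1 \<triangleright>\<^bsub>M\<^esub> (h1 \<triangleright>\<^bsub>M\<^esub> m)))"
      using m h12 unfolding V_def by (intro sweedler_lco ydl_linear_intros) auto
    also have "\<dots> = sweedler V R (\<lambda>R1 R2. ?\<beta> (R1 \<otimes>\<^bsub>H\<^esub> h1) (R2 \<otimes>\<^bsub>H\<^esub> h2))"
      using m h12 by (intro R_cong) (simp add: lact_mult)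
    finally show "sweedler V (lco (h1 \<triangleright>\<^bsub>M\<^esub> m)) (\<lambda>a m0. pure_tensor K H M (a \<otimes>\<^bsub>H\<^esub> h2) m0) = \<dots>" .
  qed
  also have "\<dots> = sweedler V (comult H h) (\<lambda>h1 h2. sweedler V R (\<lambda>R1 R2. ?\<beta> (h2 \<otimes>\<^bsub>H\<^esub> R1) (h1 \<otimes>\<^bsub>H\<^esub> R2)))"
    using m h unfolding V_def by (intro R_cop_bilinear[symmetric] ydl_linear_intros) auto
  also have "\<dots> = sweedler V (comult H h) (\<lambda>h1 h2. sweedler V (lco m) (\<lambda>a m0.
      pure_tensor K H M (h1 \<otimes>\<^bsub>H\<^esub> a) (h2 \<triangleright>\<^bsub>M\<^esub> m0)))"
  proof (rule \<Delta>_cong[OF h])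
    fix h1 h2 assume h12: "h1 \<in> carrier H" "h2 \<in> carrier H"
    have "sweedler V (lco m) (\<lambda>a m0. pure_tensor K H M (h1 \<otimes>\<^bsub>H\<^esub> a) (h2 \<triangleright>\<^bsub>M\<^esub> m0)) =
        sweedler V R (\<lambda>R1 R2. pure_tensor K H M (h1 \<otimes>\<^bsub>H\<^esub> R2) (h2 \<triangleright>\<^bsub>M\<^esub> (R1 \<triangleright>\<^bsub>M\<^esub> m)))"
      using m h12 unfolding V_def by (intro sweedler_lco ydl_linear_intros) auto
    also have "\<dots> = sweedler V R (\<lambda>R1 R2. ?\<beta> (h2 \<otimes>\<^bsub>H\<^esub> R1) (h1 \<otimes>\<^bsub>H\<^esub> R2))"
      using m h12 by (intro R_cong) (simp add: lact_mult)
    finally show "sweedler V R (\<lambda>R1 R2. ?\<beta> (h2 \<otimes>\<^bsub>H\<^esub> R1) (h1 \<otimes>\<^bsub>H\<^esub> R2)) =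
        sweedler V (lco m) (\<lambda>a m0. pure_tensor K H M (h1 \<otimes>\<^bsub>H\<^esub> a) (h2 \<triangleright>\<^bsub>M\<^esub> m0))" by simp
  qed
  finally show ?thesis .
qed

lemma ract_rco:
  assumes h: "h \<in> carrier H" and m: "m \<in> carrier M"
  defines "V \<equiv> tensor K M H"
  shows "sweedler V (comult H h) (\<lambda>h1 h2. sweedler V (rco (m \<triangleleft>\<^bsub>M\<^esub> h2)) (\<lambda>m0 b.
      pure_tensor K M H m0 (h1 \<otimes>\<^bsub>H\<^esub> b))) =
    sweedler V (comult H h) (\<lambda>h1 h2. sweedler V (rco m) (\<lambda>m0 b.
      pure_tensor K M H (m0 \<triangleleft>\<^bsub>M\<^esub> h1) (b \<otimes>\<^bsub>H\<^esub> h2)))"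
proof -
  let ?\<beta> = "\<lambda>x y. pure_tensor K M H (m \<triangleleft>\<^bsub>M\<^esub> x) y"
  have "sweedler V (comult H h) (\<lambda>h1 h2. sweedler V (rco (m \<triangleleft>\<^bsub>M\<^esub> h2)) (\<lambda>m0 b.
      pure_tensor K M H m0 (h1 \<otimes>\<^bsub>H\<^esub> b))) =
    sweedler V (comult H h) (\<lambda>h1 h2. sweedler V R (\<lambda>R1 R2. ?\<beta> (h2 \<otimes>\<^bsub>H\<^esub> R1) (h1 \<otimes>\<^bsub>H\<^esub> R2)))"
  proof (rule \<Delta>_cong[OF h])
    fix h1 h2 assume h12: "h1 \<in> carrier H" "h2 \<in> carrier H"
    have "sweedler V (rco (m \<triangleleft>\<^bsub>M\<^esub> h2)) (\<lambda>m0 b. pure_tensor K M H m0 (h1 \<otimes>\<^bsub>H\<^esub> b)) =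
        sweedler V R (\<lambda>R1 R2. pure_tensor K M H (m \<triangleleft>\<^bsub>M\<^esub> h2 \<triangleleft>\<^bsub>M\<^esub> R1) (h1 \<otimes>\<^bsub>H\<^esub> R2))"
      using m h12 unfolding V_def by (intro sweedler_rco ydl_linear_intros) auto
    also have "\<dots> = sweedler V R (\<lambda>R1 R2. ?\<beta> (h2 \<otimes>\<^bsub>H\<^esub> R1) (h1 \<otimes>\<^bsub>H\<^esub> R2))"
      using m h12 by (intro R_cong) (simp add: ract_mult)
    finally show "sweedler V (rco (m \<triangleleft>\<^bsub>M\<^esub> h2)) (\<lambda>m0 b. pure_tensor K M H m0 (h1 \<otimes>\<^bsub>H\<^esub> b)) = \<dots>" .
  qed
  also have "\<dots> = sweedler V (comult H h) (\<lambda>h1 h2. sweedler V R (\<lambda>R1 R2. ?\<beta> (R1 \<otimes>\<^bsub>H\<^esub> h1) (R2 \<otimes>\<^bsub>H\<^esub> h2)))"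
    using m h unfolding V_def by (intro R_cop_bilinear ydl_linear_intros) auto
  also have "\<dots> = sweedler V (comult H h) (\<lambda>h1 h2. sweedler V (rco m) (\<lambda>m0 b.
      pure_tensor K M H (m0 \<triangleleft>\<^bsub>M\<^esub> h1) (b \<otimes>\<^bsub>H\<^esub> h2)))"
  proof (rule \<Delta>_cong[OF h])
    fix h1 h2 assume h12: "h1 \<in> carrier H" "h2 \<in> carrier H"
    have "sweedler V (rco m) (\<lambda>m0 b. pure_tensor K M H (m0 \<triangleleft>\<^bsub>M\<^esub> h1) (b \<otimes>\<^bsub>H\<^esub> h2)) =
        sweedler V R (\<lambda>R1 R2. pure_tensor K M H (m \<triangleleft>\<^bsub>M\<^esub> R1 \<triangleleft>\<^bsub>M\<^esub> h1) (R2 \<otimes>\<^bsub>H\<^esub> h2))"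
      using m h12 unfolding V_def by (intro sweedler_rco ydl_linear_intros) auto
    also have "\<dots> = sweedler V R (\<lambda>R1 R2. ?\<beta> (R1 \<otimes>\<^bsub>H\<^esub> h1) (R2 \<otimes>\<^bsub>H\<^esub> h2))"
      using m h12 by (intro R_cong) (simp add: ract_mult)
    finally show "sweedler V R (\<lambda>R1 R2. ?\<beta> (R1 \<otimes>\<^bsub>H\<^esub> h1) (R2 \<otimes>\<^bsub>H\<^esub> h2)) =
        sweedler V (rco m) (\<lambda>m0 b. pure_tensor K M H (m0 \<triangleleft>\<^bsub>M\<^esub> h1) (b \<otimes>\<^bsub>H\<^esub> h2))" by simp
  qed
  finally show ?thesis .
qed

lemma lact_rco:
  assumes h: "h \<in> carrier H" and m: "m \<in> carrier M"
  shows "rco (h \<triangleright>\<^bsub>M\<^esub> m) = sweedler (tensor K M H) (rco m) (\<lambda>m0 b. pure_tensor K M H (h \<triangleright>\<^bsub>M\<^esub> m0) b)"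
proof -
  have "sweedler (tensor K M H) (rco m) (\<lambda>m0 b. pure_tensor K M H (h \<triangleright>\<^bsub>M\<^esub> m0) b) =
      sweedler (tensor K M H) R (\<lambda>R1 R2. pure_tensor K M H (h \<triangleright>\<^bsub>M\<^esub> (m \<triangleleft>\<^bsub>M\<^esub> R1)) R2)"
    using m h by (intro sweedler_rco ydl_linear_intros) auto
  also have "\<dots> = rco (h \<triangleright>\<^bsub>M\<^esub> m)"
    unfolding rco_def using m h by (intro R_cong) (simp add: lact_ract)
  finally show ?thesis by simp
qed

lemma ract_lco:
  assumes h: "h \<in> carrier H" and m: "m \<in> carrier M"
  shows "lco (m \<triangleleft>\<^bsub>M\<^esub> h) = sweedler (tensor K H M) (lco m) (\<lambda>a m0. pure_tensor K H M a (m0 \<triangleleft>\<^bsub>M\<^esub> h))"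
proof -
  have "sweedler (tensor K H M) (lco m) (\<lambda>a m0. pure_tensor K H M a (m0 \<triangleleft>\<^bsub>M\<^esub> h)) =
      sweedler (tensor K H M) R (\<lambda>R1 R2. pure_tensor K H M R2 (R1 \<triangleright>\<^bsub>M\<^esub> m \<triangleleft>\<^bsub>M\<^esub> h))"
    using m h by (intro sweedler_lco ydl_linear_intros) auto
  also have "\<dots> = lco (m \<triangleleft>\<^bsub>M\<^esub> h)"
    unfolding lco_def using m h by (intro R_cong) (simp add: lact_ract)
  finally show ?thesis by simp
qed

lemma ydl_bimodule_ydl_of_bimodule: "ydl_bimodule K H (ydl_of_bimodule K H R M)"
proof (intro ydl_bimodule.intro hopf_bimodule.intro hopf_bicomodule.intro)
  show "hopf_bimodule_axioms K H (ydl_of_bimodule K H R M)"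
    by (intro hopf_bimodule_axioms.intro)
      (simp_all add: lact_bilinear ract_bilinear lact_one ract_one lact_mult ract_mult lact_ract)
  show "hopf_bicomodule_axioms K H (ydl_of_bimodule K H R M)"
    by (intro hopf_bicomodule_axioms.intro)
      (simp_all add: lco_linear rco_linear lco_coassoc lco_counit rco_coassoc rco_counit lco_rco)
  show "ydl_bimodule_axioms K H (ydl_of_bimodule K H R M)"
    by (intro ydl_bimodule_axioms.intro) (simp_all add: lact_lco lact_rco ract_rco ract_lco)
qed (simp_all add: hopf_algebra_axioms)

end

lemma ydl_hom_ydl_of_bimodule:
  assumes "quasitriangular_bimodule K H R M" "quasitriangular_bimodule K H R N" "bimodule_hom K H M N f"
  shows "ydl_hom K H (ydl_of_bimodule K H R M) (ydl_of_bimodule K H R N) f"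
proof -
  interpret M: quasitriangular_bimodule K H R M by fact
  interpret N: quasitriangular_bimodule K H R N by fact
  have f: "f (h \<triangleright>\<^bsub>M\<^esub> m) = h \<triangleright>\<^bsub>N\<^esub> f m" "f (m \<triangleleft>\<^bsub>M\<^esub> h) = f m \<triangleleft>\<^bsub>N\<^esub> h"
    if "h \<in> carrier H" "m \<in> carrier M" for h m
    using assms(3) that unfolding bimodule_hom_def by auto
  have lin: "linear_map K M N f"
    using assms(3) unfolding bimodule_hom_def by auto
  note intros = M.ydl_linear_intros lin
  have "sweedler (tensor K H N) (M.lco m) (\<lambda>a m0. pure_tensor K H N a (f m0)) = N.lco (f m)"
    if m: "m \<in> carrier M" for m
  proof -
    have "sweedler (tensor K H N) (M.lco m) (\<lambda>a m0. pure_tensor K H N a (f m0)) =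
        sweedler (tensor K H N) R (\<lambda>R1 R2. pure_tensor K H N R2 (f (R1 \<triangleright>\<^bsub>M\<^esub> m)))"
      using m linear_map_closed[OF lin] by (intro M.sweedler_lco intros) auto
    also have "\<dots> = N.lco (f m)"
      unfolding N.lco_def using m by (intro M.R_cong) (simp add: f)
    finally show ?thesis .
  qed
  moreover have "sweedler (tensor K N H) (M.rco m) (\<lambda>m0 b. pure_tensor K N H (f m0) b) = N.rco (f m)"
    if m: "m \<in> carrier M" for m
  proof -
    have "sweedler (tensor K N H) (M.rco m) (\<lambda>m0 b. pure_tensor K N H (f m0) b) =
        sweedler (tensor K N H) R (\<lambda>R1 R2. pure_tensor K N H (f (m \<triangleleft>\<^bsub>M\<^esub> R1)) R2)"
      using m linear_map_closed[OF lin] by (intro M.sweedler_rco intros) auto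
    also have "\<dots> = N.rco (f m)"
      unfolding N.rco_def using m by (intro M.R_cong) (simp add: f)
    finally show ?thesis .
  qed
  ultimately show ?thesis
    using assms(3) by (simp add: ydl_hom_def)
qed

section \<open>The braiding and its square\<close>

text \<open>Two bimodules over the same quasitriangular Hopf algebra, with the braiding
  \<open>m \<otimes> n \<mapsto> R\<^sup>2 \<triangleright> n \<triangleleft> r\<^sup>1 \<otimes> R\<^sup>1 \<triangleright> m \<triangleleft> r\<^sup>2\<close> from \<open>M \<otimes> N\<close> to \<open>N \<otimes> M\<close>.\<close>

locale quasitriangular_bimodules = M: quasitriangular_bimodule K H R M + N: quasitriangular_bimodule K H R N
  for K :: "('k, 'r) ring_scheme" and H :: "('k, 'h, 'x) hopf_scheme"
    and R :: "('h \<times> 'h) list set" and M :: "('k, 'h, 'm) bimodule" and N :: "('k, 'h, 'n) bimodule"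
begin

abbreviation braid where
  "braid \<equiv> ydl_braiding K (ydl_of_bimodule K H R M) (ydl_of_bimodule K H R N)"

lemma braid_inner:
  assumes m: "m \<in> carrier M" and n: "n \<in> carrier N"
  defines "V \<equiv> tensor K N M"
  shows "sweedler V (M.lco m) (\<lambda>a m0. sweedler V (N.rco n) (\<lambda>n0 b.
      pure_tensor K N M (a \<triangleright>\<^bsub>N\<^esub> n0) (m0 \<triangleleft>\<^bsub>M\<^esub> b))) =
    sweedler V R (\<lambda>R1 R2. sweedler V R (\<lambda>r1 r2.
      pure_tensor K N M (R2 \<triangleright>\<^bsub>N\<^esub> (n \<triangleleft>\<^bsub>N\<^esub> r1)) ((R1 \<triangleright>\<^bsub>M\<^esub> m) \<triangleleft>\<^bsub>M\<^esub> r2)))"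
proof -
  note intros = M.ydl_linear_intros N.ydl_linear_intros
  have "sweedler V (M.lco m) (\<lambda>a m0. sweedler V (N.rco n) (\<lambda>n0 b.
      pure_tensor K N M (a \<triangleright>\<^bsub>N\<^esub> n0) (m0 \<triangleleft>\<^bsub>M\<^esub> b))) =
    sweedler V R (\<lambda>R1 R2. sweedler V (N.rco n) (\<lambda>n0 b.
      pure_tensor K N M (R2 \<triangleright>\<^bsub>N\<^esub> n0) ((R1 \<triangleright>\<^bsub>M\<^esub> m) \<triangleleft>\<^bsub>M\<^esub> b)))"
    using m n unfolding V_def
    by (intro M.sweedler_lco linear_map_sweedler_parameter[of "N.rco n" K N H] intros) auto
  also have "\<dots> = sweedler V R (\<lambda>R1 R2. sweedler V R (\<lambda>r1 r2.
      pure_tensor K N M (R2 \<triangleright>\<^bsub>N\<^esub> (n \<triangleleft>\<^bsub>N\<^esub> r1)) ((R1 \<triangleright>\<^bsub>M\<^esub> m) \<triangleleft>\<^bsub>M\<^esub> r2)))"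
    using m n unfolding V_def by (intro M.R_cong N.sweedler_rco intros) auto
  finally show ?thesis .
qed

lemma braid_explicit:
  assumes "t \<in> carrier (tensor K M N)"
  shows "braid t = sweedler (tensor K N M) t (\<lambda>m n.
    sweedler (tensor K N M) R (\<lambda>R1 R2. sweedler (tensor K N M) R (\<lambda>r1 r2.
      pure_tensor K N M (R2 \<triangleright>\<^bsub>N\<^esub> (n \<triangleleft>\<^bsub>N\<^esub> r1)) ((R1 \<triangleright>\<^bsub>M\<^esub> m) \<triangleleft>\<^bsub>M\<^esub> r2))))"
proof -
  have "tensor_factors K M N" by simp
  from tensor_factors.sweedler_cong[OF this assms braid_inner] show ?thesis
    by (simp add: ydl_braiding_def)
qed

lemma braid_bilinear:
  "bilinear_map K M N (tensor K N M) (\<lambda>m n.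
    sweedler (tensor K N M) R (\<lambda>R1 R2. sweedler (tensor K N M) R (\<lambda>r1 r2.
      pure_tensor K N M (R2 \<triangleright>\<^bsub>N\<^esub> (n \<triangleleft>\<^bsub>N\<^esub> r1)) ((R1 \<triangleright>\<^bsub>M\<^esub> m) \<triangleleft>\<^bsub>M\<^esub> r2))))"
  by (intro bilinear_mapI M.ydl_linear_intros N.ydl_linear_intros) auto

lemma braid_linear: "linear_map K (tensor K M N) (tensor K N M) braid"
proof -
  have "tensor_factors K M N" "module K (tensor K N M)" "module K (tensor K M N)" by simp_all
  then show ?thesis
    by (intro linear_map_cong[OF _ tensor_factors.sweedler_linear[OF _ _ braid_bilinear]] braid_explicit)
qed

lemma braid_pure:
  assumes "m \<in> carrier M" "n \<in> carrier N"
  shows "braid (pure_tensor K M N m n) =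
    sweedler (tensor K N M) R (\<lambda>R1 R2. sweedler (tensor K N M) R (\<lambda>r1 r2.
      pure_tensor K N M (R2 \<triangleright>\<^bsub>N\<^esub> (n \<triangleleft>\<^bsub>N\<^esub> r1)) ((R1 \<triangleright>\<^bsub>M\<^esub> m) \<triangleleft>\<^bsub>M\<^esub> r2)))"
proof -
  have "tensor_factors K M N" "module K (tensor K N M)" by simp_all
  from tensor_factors.sweedler_pure_tensor[OF this braid_bilinear assms] show ?thesis
    using assms by (simp add: braid_explicit)
qed

end

text \<open>Applying the braiding twice to \<open>m \<otimes> n\<close> brings in four copies \<open>a, b, c, d\<close> of \<open>R\<close>: \<open>a\<close>
  and \<open>c\<close> act on the left, \<open>b\<close> and \<open>d\<close> on the right. The result is the image of \<open>m \<otimes> n\<close> under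
  the left action of \<open>c\<^sup>2 a\<^sup>1 \<otimes> c\<^sup>1 a\<^sup>2\<close> and the right action of \<open>b\<^sup>2 d\<^sup>1 \<otimes> b\<^sup>1 d\<^sup>2\<close>, both of
  which are \<open>R\<^sub>2\<^sub>1 R = 1 \<otimes> 1\<close>.\<close>

lemma braid_braid_pure:
  assumes "triangular_hopf_algebra K H R"
    and "quasitriangular_bimodules K H R M N"
    and m: "m \<in> carrier M" and n: "n \<in> carrier N"
  shows "ydl_braiding K (ydl_of_bimodule K H R N) (ydl_of_bimodule K H R M)
      (ydl_braiding K (ydl_of_bimodule K H R M) (ydl_of_bimodule K H R N) (pure_tensor K M N m n)) =
    pure_tensor K M N m n"
proof -
  interpret triangular_hopf_algebra K H R by fact
  interpret MN: quasitriangular_bimodules K H R M N by fact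
  interpret NM: quasitriangular_bimodules K H R N M
    by (intro quasitriangular_bimodules.intro MN.N.quasitriangular_bimodule_axioms
        MN.M.quasitriangular_bimodule_axioms)
  note intros = MN.M.ydl_linear_intros MN.N.ydl_linear_intros
  let ?V = "tensor K M N"
  \<comment> \<open>\<open>x\<close> and \<open>y\<close> act on the left, \<open>z\<close> and \<open>w\<close> on the right\<close>
  let ?p = "\<lambda>x y z w. pure_tensor K M N (x \<triangleright>\<^bsub>M\<^esub> m \<triangleleft>\<^bsub>M\<^esub> z) (y \<triangleright>\<^bsub>N\<^esub> n \<triangleleft>\<^bsub>N\<^esub> w)"
  have V: "module K ?V" by simp
  have "NM.braid (MN.braid (pure_tensor K M N m n)) =
      sweedler ?V R (\<lambda>a1 a2. sweedler ?V R (\<lambda>b1 b2.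
        NM.braid (pure_tensor K N M (a2 \<triangleright>\<^bsub>N\<^esub> (n \<triangleleft>\<^bsub>N\<^esub> b1)) ((a1 \<triangleright>\<^bsub>M\<^esub> m) \<triangleleft>\<^bsub>M\<^esub> b2))))"
  proof -
    note push = tensor_factors.linear_map_sweedler[OF AA_factors R_closed _ V NM.braid_linear]
    have "NM.braid (MN.braid (pure_tensor K M N m n)) =
        sweedler ?V R (\<lambda>a1 a2. NM.braid (sweedler (tensor K N M) R (\<lambda>b1 b2.
          pure_tensor K N M (a2 \<triangleright>\<^bsub>N\<^esub> (n \<triangleleft>\<^bsub>N\<^esub> b1)) ((a1 \<triangleright>\<^bsub>M\<^esub> m) \<triangleleft>\<^bsub>M\<^esub> b2))))"
      using m n unfolding MN.braid_pure[OF m n]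
      by (intro push tensor_factors.sweedler_closed[OF AA_factors R_closed]) auto
    also have "\<dots> = sweedler ?V R (\<lambda>a1 a2. sweedler ?V R (\<lambda>b1 b2.
        NM.braid (pure_tensor K N M (a2 \<triangleright>\<^bsub>N\<^esub> (n \<triangleleft>\<^bsub>N\<^esub> b1)) ((a1 \<triangleright>\<^bsub>M\<^esub> m) \<triangleleft>\<^bsub>M\<^esub> b2))))"
      using m n by (intro MN.M.R_cong push) auto
    finally show ?thesis .
  qed
  also have "\<dots> = sweedler ?V R (\<lambda>a1 a2. sweedler ?V R (\<lambda>b1 b2. sweedler ?V R (\<lambda>c1 c2. sweedler ?V R (\<lambda>d1 d2.
      ?p (c2 \<otimes>\<^bsub>H\<^esub> a1) (c1 \<otimes>\<^bsub>H\<^esub> a2) (b2 \<otimes>\<^bsub>H\<^esub> d1) (b1 \<otimes>\<^bsub>H\<^esub> d2)))))"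
  proof (intro MN.M.R_cong)
    fix a1 a2 b1 b2
    assume ab: "a1 \<in> carrier H" "a2 \<in> carrier H" "b1 \<in> carrier H" "b2 \<in> carrier H"
    have "NM.braid (pure_tensor K N M (a2 \<triangleright>\<^bsub>N\<^esub> (n \<triangleleft>\<^bsub>N\<^esub> b1)) ((a1 \<triangleright>\<^bsub>M\<^esub> m) \<triangleleft>\<^bsub>M\<^esub> b2)) =
        sweedler ?V R (\<lambda>c1 c2. sweedler ?V R (\<lambda>d1 d2. pure_tensor K M N
          (c2 \<triangleright>\<^bsub>M\<^esub> (((a1 \<triangleright>\<^bsub>M\<^esub> m) \<triangleleft>\<^bsub>M\<^esub> b2) \<triangleleft>\<^bsub>M\<^esub> d1))
          ((c1 \<triangleright>\<^bsub>N\<^esub> (a2 \<triangleright>\<^bsub>N\<^esub> (n \<triangleleft>\<^bsub>N\<^esub> b1))) \<triangleleft>\<^bsub>N\<^esub> d2)))"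
      using m n ab by (intro NM.braid_pure) auto
    also have "\<dots> = sweedler ?V R (\<lambda>c1 c2. sweedler ?V R (\<lambda>d1 d2.
        ?p (c2 \<otimes>\<^bsub>H\<^esub> a1) (c1 \<otimes>\<^bsub>H\<^esub> a2) (b2 \<otimes>\<^bsub>H\<^esub> d1) (b1 \<otimes>\<^bsub>H\<^esub> d2)))"
      using m n ab
      by (intro MN.M.R_cong)
        (simp add: MN.M.lact_mult MN.N.lact_mult MN.M.ract_mult MN.N.ract_mult MN.M.lact_ract MN.N.lact_ract)
    finally show "NM.braid (pure_tensor K N M (a2 \<triangleright>\<^bsub>N\<^esub> (n \<triangleleft>\<^bsub>N\<^esub> b1)) ((a1 \<triangleright>\<^bsub>M\<^esub> m) \<triangleleft>\<^bsub>M\<^esub> b2)) = \<dots>" .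
  qed
  also have "\<dots> = sweedler ?V R (\<lambda>a1 a2. sweedler ?V R (\<lambda>c1 c2. sweedler ?V R (\<lambda>b1 b2. sweedler ?V R (\<lambda>d1 d2.
      ?p (c2 \<otimes>\<^bsub>H\<^esub> a1) (c1 \<otimes>\<^bsub>H\<^esub> a2) (b2 \<otimes>\<^bsub>H\<^esub> d1) (b1 \<otimes>\<^bsub>H\<^esub> d2)))))"
    using m n
    by (intro MN.M.R_cong MN.M.R_swap tensor_factors.sweedler_closed[OF AA_factors R_closed]) auto
  \<comment> \<open>\<open>R\<^sub>2\<^sub>1 R = 1 \<otimes> 1\<close> for the two copies of \<open>R\<close> that act on the right\<close>
  also have "\<dots> = sweedler ?V R (\<lambda>a1 a2. sweedler ?V R (\<lambda>c1 c2.
      ?p (c2 \<otimes>\<^bsub>H\<^esub> a1) (c1 \<otimes>\<^bsub>H\<^esub> a2) \<one>\<^bsub>H\<^esub> \<one>\<^bsub>H\<^esub>))"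
    using m n by (intro MN.M.R_cong R_flip_bilinear intros) auto
  also have "\<dots> = sweedler ?V R (\<lambda>c1 c2. sweedler ?V R (\<lambda>a1 a2.
      ?p (c2 \<otimes>\<^bsub>H\<^esub> a1) (c1 \<otimes>\<^bsub>H\<^esub> a2) \<one>\<^bsub>H\<^esub> \<one>\<^bsub>H\<^esub>))"
    using m n by (intro MN.M.R_swap) auto
  \<comment> \<open>the same for the two copies that act on the left\<close>
  also have "\<dots> = ?p \<one>\<^bsub>H\<^esub> \<one>\<^bsub>H\<^esub> \<one>\<^bsub>H\<^esub> \<one>\<^bsub>H\<^esub>"
    using m n by (intro R_flip_bilinear intros) auto
  also have "\<dots> = pure_tensor K M N m n"
    using m n by (simp add: MN.M.lact_one MN.N.lact_one MN.M.ract_one MN.N.ract_one)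
  finally show ?thesis .
qed

theorem proposition5p2:
  fixes K :: "'k ring" and H :: "('k, 'h) hopf" and R :: "('h \<times> 'h) list set"
    and M :: "('k, 'h, 'm) bimodule" and N :: "('k, 'h, 'n) bimodule"
  assumes "triangular_hopf_algebra K H R"
    and "hopf_bimodule K H M"
    and "hopf_bimodule K H N"
  shows "ydl_bimodule K H (ydl_of_bimodule K H R M) \<and>
    ydl_bimodule K H (ydl_of_bimodule K H R N) \<and>
    (\<forall>f. bimodule_hom K H M N f \<longrightarrow>
      ydl_hom K H (ydl_of_bimodule K H R M) (ydl_of_bimodule K H R N) f) \<and>
    (\<forall>t\<in>carrier (tensor K M N).
      ydl_braiding K (ydl_of_bimodule K H R N) (ydl_of_bimodule K H R M)
        (ydl_braiding K (ydl_of_bimodule K H R M) (ydl_of_bimodule K H R N) t) = t)"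
proof -
  have "quasitriangular_hopf_algebra K H R"
    using assms(1) by (rule triangular_hopf_algebra.axioms)
  then have MQ: "quasitriangular_bimodule K H R M" and NQ: "quasitriangular_bimodule K H R N"
    using assms(2,3) by (simp_all add: quasitriangular_bimodule.intro)
  interpret MN: quasitriangular_bimodules K H R M N
    using MQ NQ by (rule quasitriangular_bimodules.intro)
  interpret NM: quasitriangular_bimodules K H R N M
    using NQ MQ by (rule quasitriangular_bimodules.intro)
  have MN_factors: "tensor_factors K M N" by simp
  have "NM.braid (MN.braid t) = t" if t: "t \<in> carrier (tensor K M N)" for t
  proof -
    have lin: "linear_map K (tensor K M N) (tensor K M N) (\<lambda>t. NM.braid (MN.braid t))"
      using NM.braid_linear MN.braid_linear by (rule linear_map_compose)
    have "NM.braid (MN.braid (sweedler (tensor K M N) t (\<lambda>m n. pure_tensor K M N m n))) =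
        sweedler (tensor K M N) t (\<lambda>m n. NM.braid (MN.braid (pure_tensor K M N m n)))"
      by (rule tensor_factors.linear_map_sweedler[OF MN_factors t _ _ lin]) simp_all
    also have "\<dots> = sweedler (tensor K M N) t (\<lambda>m n. pure_tensor K M N m n)"
      by (intro tensor_factors.sweedler_cong[OF MN_factors t]
          braid_braid_pure[OF assms(1) MN.quasitriangular_bimodules_axioms])
    finally show ?thesis
      by (simp only: tensor_factors.sweedler_pure_tensor_self[OF MN_factors t])
  qed
  then show ?thesis
    using quasitriangular_bimodule.ydl_bimodule_ydl_of_bimodule[OF MQ]
      quasitriangular_bimodule.ydl_bimodule_ydl_of_bimodule[OF NQ]
      ydl_hom_ydl_of_bimodule[OF MQ NQ] by blast
qed

end
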